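(* Let $n\ge 1$. There is a lattice structure on $T_n^B$ (i.e. a partial order on $T_n^B$ which is a lattice) whose covering relations are given by: $S\lessdot T$ if and only if $S$ and $T$ differ exactly in that a green chord $C$ of $S$ and its symmetric partner $\bar C$ (also green) are replaced in $T$ by the other diagonals of $Q(C)$ and $Q(\bar C)$ (which will be red in $T$). Here $C=\bar C$ (i.e. $C$ a diameter) is allowed.
   Context: Consider a convex, centrally symmetric $(2n+2)$-gon with vertices labelled clockwise $1,2,\dots,n+1,\bar 1,\bar 2,\dots,\overline{n+1}$, so that the half-turn exchanges $i$ and $\bar i$. A triangulation is a division of the polygon into triangles by chords (segments joining two non-adjacent vertices) which do not cross in the interior. $T_n^B$ is the set of triangulations fixed under the half-turn. For a chord $C$, $\bar C$ denotes its image under the half-turn (its symmetric partner). In a triangulation $S$, each chord $C$ of $S$ is a diagonal of a unique quadrilateral $Q(C)$, the union of the two triangles of $S$ having $C$ as a side. A chord is pure if it joins two barred or two unbarred vertices; otherwise it is mixed. Colouring: a pure chord $C$ of $S$ is red if $Q(C)$ contains another vertex of the same type (barred/unbarred) as the endpoints of $C$ whose label is higher than those of both endpoints of $C$, and green otherwise. A mixed chord $C$ is red if $Q(C)$ contains an unbarred vertex whose label is higher than that of the unbarred endpoint of $C$, or a barred vertex whose label is higher than that of the barred endpoint of $C$; otherwise it is green. The chords $C$ and $\bar C$ always have the same colour. *)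

theory Defs
  imports "HOL-Algebra.Lattice"
begin

datatype vertex = Unbarred (label: nat) | is_barred: Barred (label: nat)

definition vertices :: "nat \<Rightarrow> vertex set" where
  "vertices n = {v. 1 \<le> label v \<and> label v \<le> n + 1}"

text \<open>The clockwise position, in \<open>1, \<dots>, 2n + 2\<close>, of a vertex.\<close>

definition pos :: "nat \<Rightarrow> vertex \<Rightarrow> nat" where
  "pos n v = (if is_barred v then n + 1 + label v else label v)"

fun bar :: "vertex \<Rightarrow> vertex" where
  "bar (Unbarred i) = Barred i"
| "bar (Barred i) = Unbarred i"

definition same_type :: "vertex \<Rightarrow> vertex \<Rightarrow> bool" where
  "same_type u v \<longleftrightarrow> is_barred u = is_barred v"

definition adjacent :: "nat \<Rightarrow> vertex \<Rightarrow> vertex \<Rightarrow> bool" where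
  "adjacent n u v \<longleftrightarrow>
     (pos n u + 1) mod (2 * n + 2) = pos n v mod (2 * n + 2) \<or>
     (pos n v + 1) mod (2 * n + 2) = pos n u mod (2 * n + 2)"

text \<open>A segment between two vertices is represented by the set of its endpoints.\<close>

definition sides :: "nat \<Rightarrow> vertex set set" where
  "sides n = {{u, v} | u v. u \<in> vertices n \<and> v \<in> vertices n \<and> u \<noteq> v \<and> adjacent n u v}"

definition chords :: "nat \<Rightarrow> vertex set set" where
  "chords n = {{u, v} | u v. u \<in> vertices n \<and> v \<in> vertices n \<and> u \<noteq> v \<and> \<not> adjacent n u v}"

text \<open>Since the polygon is convex, two segments between vertices cross in its interior iff
  their four endpoints are distinct and alternate along the boundary.\<close>

definition crosses :: "nat \<Rightarrow> vertex set \<Rightarrow> vertex set \<Rightarrow> bool" where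
  "crosses n C D \<longleftrightarrow>
     (\<exists>a b c d. (C = {a, b} \<and> D = {c, d} \<or> C = {c, d} \<and> D = {a, b}) \<and>
        pos n a < pos n c \<and> pos n c < pos n b \<and> pos n b < pos n d)"

text \<open>The regions into which a set \<open>S\<close> of noncrossing chords divides the polygon are convex
  polygons, each represented by its set \<open>F\<close> of vertices. Two vertices of \<open>F\<close> span a diagonal of
  the region if that segment crosses another segment between vertices of \<open>F\<close>, and a side of the
  region otherwise. Then \<open>F\<close> is a region iff its sides are chords in \<open>S\<close> or sides of the whole
  polygon, while none of its diagonals is.\<close>

definition region :: "nat \<Rightarrow> vertex set set \<Rightarrow> vertex set \<Rightarrow> bool" where
  "region n S F \<longleftrightarrow> F \<subseteq> vertices n \<and> 3 \<le> card F \<and>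
     (\<forall>a\<in>F. \<forall>b\<in>F. a \<noteq> b \<longrightarrow>
        ({a, b} \<in> S \<union> sides n \<longleftrightarrow> \<not> (\<exists>c\<in>F. \<exists>d\<in>F. crosses n {a, b} {c, d})))"

definition triangulation :: "nat \<Rightarrow> vertex set set \<Rightarrow> bool" where
  "triangulation n S \<longleftrightarrow> S \<subseteq> chords n \<and>
     (\<forall>C\<in>S. \<forall>D\<in>S. \<not> crosses n C D) \<and>
     (\<forall>F. region n S F \<longrightarrow> card F = 3)"

definition triangulations_B :: "nat \<Rightarrow> vertex set set set" where
  "triangulations_B n = {S. triangulation n S \<and> (\<lambda>C. bar ` C) ` S = S}"

text \<open>The vertex set of the quadrilateral \<open>Q(C)\<close> formed by the triangles having \<open>C\<close> as a side.\<close>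

definition quad :: "nat \<Rightarrow> vertex set set \<Rightarrow> vertex set \<Rightarrow> vertex set" where
  "quad n S C = \<Union> {F. region n S F \<and> C \<subseteq> F}"

definition other_diagonal :: "nat \<Rightarrow> vertex set set \<Rightarrow> vertex set \<Rightarrow> vertex set" where
  "other_diagonal n S C = quad n S C - C"

definition pure :: "vertex set \<Rightarrow> bool" where
  "pure C \<longleftrightarrow> (\<forall>u\<in>C. \<forall>v\<in>C. same_type u v)"

definition red :: "nat \<Rightarrow> vertex set set \<Rightarrow> vertex set \<Rightarrow> bool" where
  "red n S C \<longleftrightarrow>
     (if pure C
      then \<exists>w\<in>quad n S C. \<forall>u\<in>C. same_type w u \<and> label u < label w
      else \<exists>w\<in>quad n S C. \<exists>u\<in>C. same_type w u \<and> label u < label w)"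

abbreviation green :: "nat \<Rightarrow> vertex set set \<Rightarrow> vertex set \<Rightarrow> bool" where
  "green n S C \<equiv> \<not> red n S C"

text \<open>For a diameter, \<open>bar ` C = C\<close> and only one chord is exchanged.\<close>

definition flip :: "nat \<Rightarrow> vertex set set \<Rightarrow> vertex set \<Rightarrow> vertex set set" where
  "flip n S C =
     (S - {C, bar ` C}) \<union> {other_diagonal n S C, other_diagonal n S (bar ` C)}"

definition covered_by :: "'a gorder \<Rightarrow> 'a \<Rightarrow> 'a \<Rightarrow> bool" where
  "covered_by L x y \<longleftrightarrow> x \<in> carrier L \<and> y \<in> carrier L \<and> x \<sqsubset>\<^bsub>L\<^esub> y \<and>
     \<not> (\<exists>z\<in>carrier L. x \<sqsubset>\<^bsub>L\<^esub> z \<and> z \<sqsubset>\<^bsub>L\<^esub> y)"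

end

theory Submission
  imports Defs "HOL-Algebra.Complete_Lattice"
begin

text \<open>Put \<open>N = n + 1\<close> and number the vertices clockwise by \<open>1, \<dots>, 2N\<close>, so that \<open>1, \<dots>, N\<close> are
unbarred, \<open>N + 1, \<dots>, 2N\<close> are barred and the half-turn is \<open>p \<mapsto> p \<plusminus> N\<close>. A symmetric triangulation \<open>S\<close>
becomes the set \<open>E\<close> of its edges, chords and sides alike, written as pairs \<open>p < q\<close>; such sets are the
maximal noncrossing ones that are invariant under the half-turn (\<open>edges_triangulation\<close>,
\<open>triangulation_of_edges\<close>).

The order is read off from the left ends: for a barred vertex \<open>v < 2N\<close> let \<open>left_end E v\<close> be the
least neighbour of \<open>v\<close>, and put \<open>S \<le> T\<close> if every left end of \<open>T\<close> is at most the corresponding one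
of \<open>S\<close>. Left ends determine \<open>E\<close> (\<open>triangulation_subset_of_left_ends\<close>), so this is a partial order.

Why covers are green flips. Let \<open>a < b < c < d\<close> be the quadrilateral of a chord. Of its two diagonals
\<open>{b, d}\<close> is the green one, unless \<open>d\<close> alone is barred, in which case it is \<open>{a, c}\<close>; since the half-turn
exchanges the case of one barred vertex with that of three and the case of none with that of four,
every green chord is up to the half-turn a diagonal \<open>{b, d}\<close> with \<open>c\<close> barred. Flipping it lowers the
left end of \<open>c\<close> from \<open>b\<close> to \<open>a\<close>; if \<open>b\<close> is unbarred, its partner also lowers the left end of \<open>a + N\<close>;
no other left end changes (\<open>raise_left_ends\<close>). Hence green flips go up in the order. Conversely, if
\<open>S < T\<close>, then some green flip of \<open>S\<close> is still at most \<open>T\<close> (\<open>raise_towards\<close>), so covers are green flips; and two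
green flips of \<open>S\<close> are comparable only if they flip the same chord or its partner
(\<open>comparable_raises\<close>), so nothing lies strictly between \<open>S\<close> and a green flip of \<open>S\<close>.

Why the order is a lattice. The functions \<open>left_end E\<close> are characterized by a few inequalities,
the left codes (\<open>left_code_left_end\<close>, \<open>triangulation_of_left_code\<close>). All but one of these conditions
survive pointwise maxima, and the last one is restored by moving values up to the next admissible
place, which yields the greatest lower bound of any family (\<open>infimum_of_left_ends\<close>). As the empty
family is included, there is a top element, and the order is a complete lattice.\<close>

section \<open>Pairs of positions and the half-turn\<close>

definition pairs :: "nat \<Rightarrow> (nat \<times> nat) set" where
  "pairs N = {(p, q). 1 \<le> p \<and> p < q \<and> q \<le> 2 * N}"

definition boundary :: "nat \<Rightarrow> (nat \<times> nat) set" where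
  "boundary N = {(p, q). 1 \<le> p \<and> p < q \<and> q \<le> 2 * N \<and> (q = p + 1 \<or> p = 1 \<and> q = 2 * N)}"

definition cross :: "nat \<times> nat \<Rightarrow> nat \<times> nat \<Rightarrow> bool" where
  "cross x y \<longleftrightarrow> fst x < fst y \<and> fst y < snd x \<and> snd x < snd y \<or>
                fst y < fst x \<and> fst x < snd y \<and> snd y < snd x"

text \<open>The half-turn on increasing pairs: shifting both ends by \<open>N\<close> modulo \<open>2N\<close> reverses their order
exactly when \<open>p\<close> is unbarred and \<open>q\<close> is barred.\<close>

definition opp :: "nat \<Rightarrow> nat \<times> nat \<Rightarrow> nat \<times> nat" where
  "opp N = (\<lambda>(p, q). if q \<le> N then (p + N, q + N)
                      else if p \<le> N then (q - N, p + N) else (p - N, q - N))"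

lemma opp_pairs: "x \<in> pairs N \<Longrightarrow> opp N x \<in> pairs N"
  by (auto simp: pairs_def opp_def split: if_splits)

lemma opp_opp: "x \<in> pairs N \<Longrightarrow> opp N (opp N x) = x"
  by (auto simp: pairs_def opp_def split: if_splits)

lemma cross_sym: "cross x y \<longleftrightarrow> cross y x"
  by (auto simp: cross_def)

lemma cross_opp_imp: "x \<in> pairs N \<Longrightarrow> y \<in> pairs N \<Longrightarrow> cross x y \<Longrightarrow> cross (opp N x) (opp N y)"
  by (cases x; cases y) (auto simp: pairs_def opp_def cross_def)

lemma cross_opp: "x \<in> pairs N \<Longrightarrow> y \<in> pairs N \<Longrightarrow> cross (opp N x) (opp N y) \<longleftrightarrow> cross x y"
  using cross_opp_imp[of x N y] cross_opp_imp[of "opp N x" N "opp N y"]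
  by (auto simp: opp_pairs opp_opp)

text \<open>The endpoints \<open>p\<close> and \<open>p \<plusminus> N\<close> cut the polygon into two halves; a segment from \<open>p\<close> lies in one
of them and its image in the other. This is why a maximal invariant noncrossing set is already
maximal among all noncrossing sets.\<close>

lemma not_cross_opp: "x \<in> pairs N \<Longrightarrow> \<not> cross x (opp N x)"
  by (cases x) (auto simp: pairs_def opp_def cross_def)

lemma boundary_pairs: "boundary N \<subseteq> pairs N"
  by (auto simp: boundary_def pairs_def)

lemma not_cross_boundary: "x \<in> boundary N \<Longrightarrow> y \<in> pairs N \<Longrightarrow> \<not> cross x y"
  by (auto simp: boundary_def pairs_def cross_def)

lemma opp_boundary: "x \<in> boundary N \<Longrightarrow> opp N x \<in> boundary N"
  by (cases x) (auto simp: boundary_def opp_def split: if_splits)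

section \<open>Symmetric triangulations as maximal noncrossing sets\<close>

locale symmetric_triangulation =
  fixes N :: nat and E :: "(nat \<times> nat) set"
  assumes N_ge_2: "2 \<le> N"
    and E_pairs: "E \<subseteq> pairs N"
    and boundary_E: "boundary N \<subseteq> E"
    and noncrossing: "x \<in> E \<Longrightarrow> y \<in> E \<Longrightarrow> \<not> cross x y"
    and maximal: "x \<in> pairs N \<Longrightarrow> (\<And>y. y \<in> E \<Longrightarrow> \<not> cross x y) \<Longrightarrow> x \<in> E"
    and opp_E: "x \<in> E \<Longrightarrow> opp N x \<in> E"

lemma finite_pairs: "finite (pairs N)"
  by (rule finite_subset[of _ "{0..2*N} \<times> {0..2*N}"]) (auto simp: pairs_def)

text \<open>Triangulations with prescribed edges are obtained by enlarging to a maximal invariant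
noncrossing set: a pair that crosses no member can be added together with its image under the
half-turn, since the two do not cross each other.\<close>

lemma extend_to_triangulation:
  assumes N: "2 \<le> N" and H: "H \<subseteq> pairs N" 
    and nc: "\<And>x y. x \<in> H \<Longrightarrow> y \<in> H \<Longrightarrow> \<not> cross x y" 
    and op: "\<And>x. x \<in> H \<Longrightarrow> opp N x \<in> H"
  obtains E where "symmetric_triangulation N E" "H \<subseteq> E"
proof -
  define ok where "ok = {E. H \<union> boundary N \<subseteq> E \<and> E \<subseteq> pairs N \<and>
    (\<forall>x\<in>E. \<forall>y\<in>E. \<not> cross x y) \<and> opp N ` E \<subseteq> E}"
  have "ok \<subseteq> Pow (pairs N)" by (auto simp: ok_def)
  then have fin: "finite ok" by (rule finite_subset) (simp add: finite_pairs)
  have "\<not> cross x y" if "x \<in> H \<union> boundary N" "y \<in> H \<union> boundary N" for x y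
  proof (cases "x \<in> boundary N \<or> y \<in> boundary N")
    case True
    then show ?thesis using that H boundary_pairs[of N] not_cross_boundary cross_sym by blast
  qed (use that nc in auto)
  then have "H \<union> boundary N \<in> ok"
    unfolding ok_def using H boundary_pairs[of N] op opp_boundary by auto
  then obtain E where E: "E \<in> ok" and mx: "\<And>E'. E' \<in> ok \<Longrightarrow> E \<subseteq> E' \<Longrightarrow> E' = E"
    using finite_has_maximal[OF fin] by (metis empty_iff)
  have "symmetric_triangulation N E"
  proof
    fix x assume x: "x \<in> pairs N" and c: "\<And>y. y \<in> E \<Longrightarrow> \<not> cross x y"
    have c': "\<not> cross (opp N x) y" if "y \<in> E" for y
    proof -
      have "opp N y \<in> E" "y \<in> pairs N" using E that by (auto simp: ok_def)
      then show ?thesis using c cross_opp[of x N "opp N y"] x opp_opp opp_pairs by metis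
    qed
    have "x \<in> E \<union> {x, opp N x}" by simp
    moreover have "E \<union> {x, opp N x} \<in> ok"
      unfolding ok_def mem_Collect_eq
    proof (intro conjI ballI)
      show "\<not> cross y z" if "y \<in> E \<union> {x, opp N x}" "z \<in> E \<union> {x, opp N x}" for y z
      proof -
        have "\<not> cross y y" "\<not> cross z z" by (auto simp: cross_def)
        then show ?thesis
          using that E c c' cross_sym[of y z] cross_sym[of x "opp N x"] not_cross_opp[OF x] unfolding ok_def
          by blast
      qed
    qed (use E x opp_opp opp_pairs in \<open>auto simp: ok_def\<close>)
    ultimately show "x \<in> E" using mx by blast
  qed (use E N in \<open>auto simp: ok_def\<close>)
  with E show ?thesis by (auto simp: ok_def intro: that)
qed

section \<open>Left ends and left codes\<close>

definition left_end :: "(nat \<times> nat) set \<Rightarrow> nat \<Rightarrow> nat" where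
  "left_end E v = (LEAST p. (p, v) \<in> E)"

lemma left_end_le: "(p, v) \<in> E \<Longrightarrow> left_end E v \<le> p"
  unfolding left_end_def by (rule Least_le)

context symmetric_triangulation
begin

lemma E_range: "(p, q) \<in> E \<Longrightarrow> 1 \<le> p \<and> p < q \<and> q \<le> 2 * N"
  using E_pairs by (auto simp: pairs_def)

lemma no_cross: "(p, q) \<in> E \<Longrightarrow> (r, s) \<in> E \<Longrightarrow> p < r \<Longrightarrow> r < q \<Longrightarrow> q < s \<Longrightarrow> False"
  using noncrossing[of "(p, q)" "(r, s)"] by (auto simp: cross_def)

lemma adjacent_E: "1 \<le> p \<Longrightarrow> p < 2 * N \<Longrightarrow> (p, p + 1) \<in> E"
  using boundary_E by (auto simp: boundary_def)

lemma long_side_E: "(1, 2 * N) \<in> E"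
  using boundary_E N_ge_2 by (auto simp: boundary_def)

lemma opp_low: "(p, q) \<in> E \<Longrightarrow> q \<le> N \<Longrightarrow> (p + N, q + N) \<in> E"
  using opp_E[of "(p, q)"] by (auto simp: opp_def)

lemma opp_mixed: "(p, q) \<in> E \<Longrightarrow> p \<le> N \<Longrightarrow> N < q \<Longrightarrow> (q - N, p + N) \<in> E"
  using opp_E[of "(p, q)"] by (auto simp: opp_def)

lemma opp_high: "(p, q) \<in> E \<Longrightarrow> N < p \<Longrightarrow> (p - N, q - N) \<in> E"
  using opp_E[of "(p, q)"] E_range[of p q] by (auto simp: opp_def)

text \<open>The apex is the last neighbour \<open>m\<close> of \<open>p\<close> before \<open>q\<close>: an edge crossing \<open>(m, q)\<close> without
crossing \<open>(p, m)\<close> or \<open>(p, q)\<close> would have to start at \<open>p\<close> and end after \<open>m\<close>.\<close>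

lemma inner_triangle:
  assumes pq: "(p, q) \<in> E" and "p + 1 < q"
  obtains m where "p < m" "m < q" "(p, m) \<in> E" "(m, q) \<in> E"
proof -
  define A where "A = {m. p < m \<and> m < q \<and> (p, m) \<in> E}"
  define m where "m = Max A"
  have fin: "finite A" by (auto simp: A_def)
  have "p + 1 \<in> A" using assms E_range[OF pq] adjacent_E[of p] by (auto simp: A_def)
  then have mA: "m \<in> A" unfolding m_def using fin Max_in by blast
  have mx: "k \<le> m" if "p < k" "k < q" "(p, k) \<in> E" for k
    unfolding m_def using that fin by (auto simp: A_def intro: Max_ge)
  have "(m, q) \<in> E"
  proof (rule maximal)
    show "(m, q) \<in> pairs N" using mA E_range[OF pq] by (auto simp: A_def pairs_def)
    fix y assume y: "y \<in> E"
    obtain r s where rs: "y = (r, s)" by force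
    show "\<not> cross (m, q) y"
    proof
      assume "cross (m, q) y"
      then consider "m < r" "r < q" "q < s" | "r < m" "m < s" "s < q" 
        by (auto simp: rs cross_def)
      then show False
      proof cases
        case 1 then show ?thesis using no_cross[OF pq, of r s] y mA by (auto simp: rs A_def)
      next
        case 2
        consider "r < p" | "r = p" | "p < r" by linarith
        then show ?thesis 
        proof cases
          case 1
          then show ?thesis using no_cross[of r s p q] y 2 pq mA by (auto simp: rs A_def)
        next
          case _: 2
          then show ?thesis using mx[of s] 2 mA y by (auto simp: rs A_def)
        next
          case 3
          then show ?thesis using no_cross[of p m r s] y 2 mA by (auto simp: rs A_def)
        qed
      qed
    qed
  qed
  with mA show ?thesis by (auto simp: A_def intro: that)
qed

text \<open>Among the edges other than \<open>(p, q)\<close> that span \<open>p\<close> and \<open>q\<close>, take a shortest one; its inner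
triangle has \<open>(p, q)\<close> as a side.\<close>

lemma outer_triangle:
  assumes pq: "(p, q) \<in> E" and "(p, q) \<noteq> (1, 2 * N)"
  obtains m where "m < p" "(m, p) \<in> E" "(m, q) \<in> E"
    | m where "q < m" "(p, m) \<in> E" "(q, m) \<in> E"
proof -
  define P where "P k \<longleftrightarrow> (\<exists>r s. (r, s) \<in> E \<and> r \<le> p \<and> q \<le> s \<and> (r, s) \<noteq> (p, q) \<and> k = s - r)" for k
  have "P (2 * N - 1)" using assms long_side_E E_range[OF pq] unfolding P_def by blast
  then have "P (LEAST k. P k)" by (rule LeastI)
  then obtain r s where rs: "(r, s) \<in> E" "r \<le> p" "q \<le> s" "(r, s) \<noteq> (p, q)" "(LEAST k. P k) = s - r"
    unfolding P_def by blast
  have least: "(r', s') = (p, q)" if "(r', s') \<in> E" "r' \<le> p" "q \<le> s'" "s' - r' < s - r" for r' s'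
  proof (rule ccontr)
    assume "(r', s') \<noteq> (p, q)"
    then have "P (s' - r')" using that unfolding P_def by blast
    then show False using that rs(5) not_less_Least by metis
  qed
  have lt: "p < q" "r < s" using E_range pq rs(1) by auto
  have "r + 1 < s" using rs lt by auto
  then obtain m where m: "r < m" "m < s" "(r, m) \<in> E" "(m, s) \<in> E"
    using inner_triangle rs(1) by blast
  consider "m \<le> p" | "q \<le> m" | "p < m" "m < q" by linarith
  then show ?thesis
  proof cases
    case 1
    then have "(m, s) = (p, q)" using least[of m s] m rs by auto
    then show ?thesis using that(1)[of r] m rs by auto
  next
    case 2
    then have "(r, m) = (p, q)" using least[of r m] m rs by auto
    then show ?thesis using that(2)[of s] m rs by auto
  next
    case 3
    then have "r = p" using no_cross[OF m(3) pq] rs by fastforce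
    moreover have "s = q" using no_cross[OF pq m(4)] rs 3 by fastforce
    ultimately show ?thesis using rs by simp
  qed
qed

lemma left_edge: "1 < v \<Longrightarrow> v \<le> 2 * N \<Longrightarrow> (left_end E v, v) \<in> E"
  unfolding left_end_def using adjacent_E[of "v - 1"] by (intro LeastI[of "\<lambda>p. (p, v) \<in> E" "v - 1"]) simp

lemma left_end_range: "1 < v \<Longrightarrow> v \<le> 2 * N \<Longrightarrow> 1 \<le> left_end E v \<and> left_end E v < v"
  using left_edge[of v] E_range by blast

lemma left_end_ge: "(p, q) \<in> E \<Longrightarrow> p < v \<Longrightarrow> v < q \<Longrightarrow> p \<le> left_end E v"
proof (rule ccontr)
  assume pq: "(p, q) \<in> E" "p < v" "v < q" and "\<not> p \<le> left_end E v"
  then have "left_end E v < p" "(left_end E v, v) \<in> E" using E_range[OF pq(1)] left_edge[of v] by simp_all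
  then show False using no_cross[OF _ pq(1)] pq by blast
qed

lemma left_end_eq: "(p, q) \<in> E \<Longrightarrow> v < q \<Longrightarrow> (p, v) \<in> E \<Longrightarrow> left_end E v = p"
  using left_end_ge[of p q v] left_end_le[of p v E] E_range[of p v] by simp

lemma left_end_top: "left_end E (2 * N) = 1"
  using left_end_le[OF long_side_E] left_end_range[of "2 * N"] N_ge_2 by linarith

text \<open>The outer triangle of \<open>(left_end E v, v)\<close> cannot have its apex below the left end, so \<open>v\<close> is
the middle vertex of a triangle.\<close>

lemma right_end:
  assumes "1 < v" "v < 2 * N"
  obtains r where "v < r" "(left_end E v, r) \<in> E" "(v, r) \<in> E"
proof -
  have "(left_end E v, v) \<noteq> (1, 2 * N)" using assms by auto
  with left_edge[of v] assms have "(left_end E v, v) \<in> E" "(left_end E v, v) \<noteq> (1, 2 * N)"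
    by simp_all
  then show ?thesis
  proof (rule outer_triangle)
    fix m assume "m < left_end E v" "(m, v) \<in> E"
    then show ?thesis using left_end_le[of m v E] by simp
  qed (rule that)
qed

end

text \<open>The conditions on left ends of barred vertices. The third conjunct is the noncrossing condition for
the chords \<open>(f v, v)\<close> themselves, as for bracket vectors of the ordinary Tamari lattice; the fourth
is the noncrossing condition between such a chord and the image \<open>(u - N, f u + N)\<close> of another one that joins
a barred to an unbarred vertex, and if \<open>f v = u - N\<close>, it says that the image \<open>(v - N, u)\<close> of \<open>(f v, v)\<close> is
respected by the left end of \<open>u\<close>; the last holds because the half-turn maps the chord \<open>(f v, v)\<close> to
\<open>(v - N, f v + N)\<close>, which gives \<open>f v + N\<close> an unbarred neighbour. The value at \<open>2N\<close>, where every
triangulation has the side \<open>(1, 2N)\<close>, makes sure that a right end exists for each \<open>v\<close>.\<close>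

definition left_code :: "nat \<Rightarrow> (nat \<Rightarrow> nat) \<Rightarrow> bool" where
  "left_code N f \<longleftrightarrow> f (2 * N) = 1 \<and>
     (\<forall>v. N < v \<and> v < 2 * N \<longrightarrow> 1 \<le> f v \<and> f v < v) \<and>
     (\<forall>u v. N < u \<and> u < v \<and> v < 2 * N \<and> f v < u \<longrightarrow> f v \<le> f u) \<and>
     (\<forall>u v. N < u \<and> u < 2 * N \<and> N < v \<and> v < 2 * N \<and> f v + N \<le> u \<and> f u \<le> N \<longrightarrow> f u + N \<le> v) \<and>
     (\<forall>v. N < v \<and> v < 2 * N \<and> f v < N \<longrightarrow> f (f v + N) \<le> N)"

lemma (in symmetric_triangulation) left_code_left_end: "left_code N (left_end E)"
  unfolding left_code_def
proof (intro conjI allI impI)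
  show "left_end E (2 * N) = 1" by (rule left_end_top)
next
  fix v assume "N < v \<and> v < 2 * N"
  then show "1 \<le> left_end E v" "left_end E v < v" using left_end_range[of v] N_ge_2 by linarith+
next
  fix u v assume "N < u \<and> u < v \<and> v < 2 * N \<and> left_end E v < u"
  then show "left_end E v \<le> left_end E u"
    by (intro left_end_ge[OF left_edge[of v]]) auto
next
  fix u v assume *: "N < u \<and> u < 2 * N \<and> N < v \<and> v < 2 * N \<and> left_end E v + N \<le> u \<and> left_end E u \<le> N"
  have v: "(left_end E v, v) \<in> E" using * N_ge_2 by (intro left_edge) auto
  have u: "(u - N, left_end E u + N) \<in> E" using * N_ge_2 by (intro opp_mixed left_edge) auto
  show "left_end E u + N \<le> v"
  proof (cases "left_end E v + N = u")
    case True
    then have "(v - N, u) \<in> E" using opp_mixed[OF v] * by auto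
    then have "left_end E u \<le> v - N" by (rule left_end_le)
    then show ?thesis using * by linarith
  next
    case False
    then have "left_end E v < u - N" "u - N < v" using * by linarith+
    then show ?thesis using no_cross[OF v u] not_le by blast
  qed
next
  fix v assume *: "N < v \<and> v < 2 * N \<and> left_end E v < N"
  then have "(v - N, left_end E v + N) \<in> E" using N_ge_2 by (intro opp_mixed left_edge) auto
  then have "left_end E (left_end E v + N) \<le> v - N" by (rule left_end_le)
  then show "left_end E (left_end E v + N) \<le> N" using * by linarith
qed


text \<open>The set \<open>G\<close> consists of the pairs \<open>(p, x)\<close> ending in a barred vertex that a triangulation with left
ends \<open>f\<close> can contain as far as \<open>f\<close> tells: \<open>p\<close> does not precede the left end of \<open>x\<close>, nor do the left ends
of the barred vertices between \<open>p\<close> and \<open>x\<close> precede \<open>p\<close>, and if \<open>p < N\<close>, then \<open>p + N\<close> has an unbarred left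
end, as the image of the pair requires. The code
conditions say that \<open>G\<close> and its image are noncrossing, so they extend to a triangulation. The left end
of \<open>v\<close> in it is at most \<open>f v\<close> because \<open>(f v, v)\<close> is in \<open>G\<close>, and at least \<open>f v\<close> because \<open>G\<close> also contains
an edge \<open>(f v, r)\<close> passing over \<open>v\<close>.\<close>

lemma triangulation_of_left_code:
  assumes N: "2 \<le> N" and f: "left_code N f"
  obtains E where "symmetric_triangulation N E" 
    and "\<And>v. N < v \<Longrightarrow> v < 2 * N \<Longrightarrow> left_end E v = f v"
proof -
  have f_top: "f (2 * N) = 1" and f_range: "\<And>v. N < v \<Longrightarrow> v < 2 * N \<Longrightarrow> 1 \<le> f v \<and> f v < v"
    and f_nested: "\<And>u v. N < u \<Longrightarrow> u < v \<Longrightarrow> v < 2 * N \<Longrightarrow> f v < u \<Longrightarrow> f v \<le> f u"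
    and f_opp: "\<And>u v. N < u \<Longrightarrow> u < 2 * N \<Longrightarrow> N < v \<Longrightarrow> v < 2 * N \<Longrightarrow>
                  f v + N \<le> u \<Longrightarrow> f u \<le> N \<Longrightarrow> f u + N \<le> v"
    and f_mixed: "\<And>v. N < v \<Longrightarrow> v < 2 * N \<Longrightarrow> f v < N \<Longrightarrow> f (f v + N) \<le> N"
    using f unfolding left_code_def by blast+
  define G where "G = {(p, x). 1 \<le> p \<and> p < x \<and> N < x \<and> x \<le> 2 * N \<and> f x \<le> p \<and>
    (p < N \<longrightarrow> f (p + N) \<le> N) \<and> (\<forall>u. N < u \<and> p < u \<and> u < x \<longrightarrow> p \<le> f u)}"
  have G_pairs: "G \<subseteq> pairs N" by (auto simp: G_def pairs_def)
  have GD: "1 \<le> p" "p < x" "N < x" "x \<le> 2 * N" "f x \<le> p" "p < N \<Longrightarrow> f (p + N) \<le> N" 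
    "\<And>u. N < u \<Longrightarrow> p < u \<Longrightarrow> u < x \<Longrightarrow> p \<le> f u" if "(p, x) \<in> G" for p x
    using that by (auto simp: G_def)
  have GG1: False if "(p, x) \<in> G" "(p', x') \<in> G" "p < p'" "p' < x" "x < x'" for p x p' x'
  proof -
    have "p' \<le> f x" using that GD(3)[OF that(1)] by (intro GD(7)[OF that(2)])
    then show False using GD(5)[OF that(1)] that(3) by linarith
  qed
  have GG: "\<not> cross x y" if "x \<in> G" "y \<in> G" for x y
    using GG1[of "fst x" "snd x" "fst y" "snd y"] GG1[of "fst y" "snd y" "fst x" "snd x"] that
    unfolding cross_def prod.collapse by blast
  have mixed: False
    if G: "(p, x) \<in> G" "(p', x') \<in> G" and "p' \<le> N" "x' - N < p" "p < p' + N" "p' + N < x" for p x p' x'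
  proof -
    note 1 = GD[OF G(1)] and 2 = GD[OF G(2)]
    have "p' < N" using that(6) 1(4) by linarith
    then have u: "f (p' + N) \<le> N" by (rule 2(6))
    have pu: "p \<le> f (p' + N)" using that(5,6) 2(1) by (intro 1(7)) simp_all
    have x': "x' < p + N" using that(4) by (simp add: less_diff_conv2 2(3) order.strict_implies_order)
    have *: "x' < 2 * N" using x' pu u by linarith
    have "p' + N < 2 * N" using \<open>p' < N\<close> by simp
    moreover have "N < p' + N" using 2(1) by simp
    moreover have "f x' + N \<le> p' + N" using 2(5) by simp
    ultimately have "f (p' + N) + N \<le> x'"
      using f_opp[OF _ _ 2(3) * _ u] by blast
    then show False using x' pu by linarith
  qed
  have Gopp: "\<not> cross x (opp N y)" if "x \<in> G" "y \<in> G" for x y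
  proof
    assume c: "cross x (opp N y)"
    obtain p q p' q' where xy: "x = (p, q)" "y = (p', q')" by force
    show False
    proof (cases "p' \<le> N")
      case True
      then have "opp N y = (q' - N, p' + N)" using that by (auto simp: xy G_def opp_def)
      then consider "q' - N < p" "p < p' + N" "p' + N < q" | "p < q' - N" "q < p' + N"
        using c by (auto simp: xy cross_def)
      then show False
      proof cases
        case 1
        then show ?thesis using mixed[of p q p' q'] that True by (auto simp: xy)
      next
        case 2
        then have "p \<le> N" "q - N < p'" "p' < p + N" "p + N < q'"
          using GD(3,4)[of p' q'] GD(1,3,4)[of p q] that True by (auto simp: xy)
        then show ?thesis using mixed[of p' q' p q] that True by (auto simp: xy)
      qed
    next
      case False
      then have "opp N y = (p' - N, q' - N)" using that by (auto simp: xy G_def opp_def)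
      moreover have "q' - N \<le> N" "N < q" using GD(3,4) that by (force simp: xy)+
      ultimately have "p' - N < p" "p < q' - N" using c by (auto simp: xy cross_def)
      then have *: "p' < p + N" "p + N < q'" "p < N" using False \<open>q' - N \<le> N\<close> by linarith+
      then have "p' \<le> f (p + N)" using GD(7)[of p' q' "p + N"] GD(1)[of p q] that by (auto simp: xy)
      moreover have "f (p + N) \<le> N" using GD(6)[of p q] that * by (auto simp: xy)
      ultimately show False using False by linarith
    qed
  qed
  have "\<not> cross x y" if xy: "x \<in> G \<union> opp N ` G" "y \<in> G \<union> opp N ` G" for x y
  proof -
    have p: "z \<in> pairs N" if "z \<in> G" for z using that G_pairs by auto
    from xy show ?thesis
      using GG Gopp cross_sym[of x y] cross_opp[OF p p] by blast
  qed
  moreover have "opp N x \<in> G \<union> opp N ` G" if "x \<in> G \<union> opp N ` G" for x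
    using that opp_opp G_pairs by auto
  moreover have "G \<union> opp N ` G \<subseteq> pairs N" using G_pairs opp_pairs by blast
  ultimately obtain E where E: "symmetric_triangulation N E" "G \<union> opp N ` G \<subseteq> E"
    using extend_to_triangulation[OF N, of "G \<union> opp N ` G"] by metis
  interpret symmetric_triangulation N E by (rule E)
  have "left_end E v = f v" if v: "N < v" "v < 2 * N" for v
  proof -
    have 1: "(f v, v) \<in> G" 
      using f_range[OF v] f_mixed[OF v] f_nested[OF _ _ v(2)] v by (auto simp: G_def)
    define r where "r = (LEAST w. v < w \<and> f w \<le> f v)"
    have ex: "v < 2 * N \<and> f (2 * N) \<le> f v" using v f_top f_range[OF v] by auto
    have r: "v < r" "f r \<le> f v" unfolding r_def using LeastI[of "\<lambda>w. v < w \<and> f w \<le> f v", OF ex] by auto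
    have r_le: "r \<le> 2 * N" unfolding r_def using ex by (rule Least_le)
    have after: "f v < f u" if "v < u" "u < r" for u
      using that not_less_Least[of u "\<lambda>w. v < w \<and> f w \<le> f v"] unfolding r_def by auto
    have "f v \<le> f u" if "N < u" "f v < u" "u < r" for u
      using that after[of u] f_nested[of u v] v by (cases u v rule: linorder_cases) auto
    then have 2: "(f v, r) \<in> G" using GD(1,2,6)[OF 1] r r_le v by (auto simp: G_def)
    show ?thesis using 1 2 E(2) r(1) by (intro left_end_eq) auto
  qed
  with E(1) show ?thesis by (rule that)
qed

text \<open>The right end \<open>r\<close> of a barred vertex \<open>k\<close> is the first vertex after \<open>k\<close> whose left end is at most that
of \<open>k\<close>, hence is determined by the left ends. So are the edges of the triangle with middle vertex \<open>k\<close>,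
and up to the half-turn every chord \<open>(p, q)\<close> with \<open>q\<close> barred belongs to such a triangle: consider the
apex \<open>k\<close> of its inner triangle. If \<open>k\<close> is barred, it is the middle vertex; if not, the image of
\<open>(p, q)\<close> is the left edge at \<open>p + N\<close>.\<close>

lemma triangulation_subset_of_left_ends:
  assumes E: "symmetric_triangulation N E" and F: "symmetric_triangulation N F"
    and eq: "\<And>v. N < v \<Longrightarrow> v < 2 * N \<Longrightarrow> left_end E v = left_end F v"
  shows "E \<subseteq> F"
proof -
  interpret E: symmetric_triangulation N E by (rule E)
  interpret F: symmetric_triangulation N F by (rule F)
  have eq': "left_end E v = left_end F v" if "N < v" "v \<le> 2 * N" for v
    using that eq[of v] E.left_end_top F.left_end_top by (cases "v = 2 * N") simp_all
  have outer: "(p, r) \<in> F" if k: "N < k" "(p, k) \<in> E" "(p, r) \<in> E" "(k, r) \<in> E" for p k r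
  proof -
    have kr: "k < r" "r \<le> 2 * N" using E.E_range k(4) by blast+
    have lE: "left_end E k = p" using E.left_end_eq k kr by blast
    have "1 < k" "k < 2 * N" using k(1) kr E.N_ge_2 by linarith+
    then obtain s where s: "k < s" "(left_end F k, s) \<in> F" "(k, s) \<in> F" using F.right_end by blast
    have lF: "left_end F k = p" using lE eq'[of k] k(1) kr by simp
    have "s \<le> 2 * N" using F.E_range s(3) by blast
    have "left_end E r \<le> p" "p < k" using left_end_le[OF k(3)] E.E_range[OF k(2)] by simp_all
    have "left_end F s \<le> p" using left_end_le[OF s(2)] lF by simp
    have "\<not> r < s"
      using F.left_end_ge[OF s(3) kr(1)] \<open>left_end E r \<le> p\<close> \<open>p < k\<close> eq'[of r] k(1) kr by fastforce
    moreover have "\<not> s < r"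
      using E.left_end_ge[OF k(4) s(1)] \<open>left_end F s \<le> p\<close> \<open>p < k\<close> eq'[of s] k(1) \<open>s \<le> 2 * N\<close> s(1)
      by fastforce
    ultimately show ?thesis using s(2) lF by simp
  qed
  have barred: "(p, q) \<in> F" if pq: "(p, q) \<in> E" "N < q" for p q
  proof (cases "q = p + 1")
    case True
    then show ?thesis using F.adjacent_E[of p] E.E_range[OF pq(1)] by simp
  next
    case False
    have r: "1 \<le> p" "p < q" "q \<le> 2 * N" using E.E_range[OF pq(1)] by simp_all
    with False have "p + 1 < q" by simp
    then obtain k where k: "p < k" "k < q" "(p, k) \<in> E" "(k, q) \<in> E"
      using E.inner_triangle[OF pq(1)] by blast
    show ?thesis
    proof (cases "N < k")
      case True
      then show ?thesis using outer k pq(1) by blast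
    next
      case False
      then have o: "(q - N, p + N) \<in> E" "(q - N, k + N) \<in> E"
        using E.opp_mixed k pq by simp_all
      have l: "left_end E (p + N) = q - N" using E.left_end_eq[OF o(2) _ o(1)] k by simp
      have "N < p + N" "p + N < 2 * N" using k False r by linarith+
      then have "(q - N, p + N) \<in> F" using F.left_edge[of "p + N"] eq[of "p + N"] l r by simp
      then show ?thesis using F.opp_mixed[of "q - N" "p + N"] r pq(2) by simp
    qed
  qed
  have "(p, q) \<in> F" if "(p, q) \<in> E" for p q
  proof (cases "N < q")
    case False
    then have "(p + N, q + N) \<in> F" using barred E.opp_low that E.E_range[OF that] by simp
    then show ?thesis using F.opp_high[of "p + N" "q + N"] E.E_range[OF that] by simp
  qed (use that barred in blast)
  then show ?thesis by auto
qed

section \<open>Upward flips\<close>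

text \<open>A quadrilateral with diagonal \<open>(b, d)\<close>. Requiring \<open>c\<close> to be barred makes this diagonal green and
selects one or both members of each half-turn orbit of green chords.\<close>

definition up_quad :: "nat \<Rightarrow> (nat \<times> nat) set \<Rightarrow> nat \<Rightarrow> nat \<Rightarrow> nat \<Rightarrow> nat \<Rightarrow> bool" where
  "up_quad N E a b c d \<longleftrightarrow> a < b \<and> b < c \<and> c < d \<and> N < c \<and>
     (a, b) \<in> E \<and> (b, c) \<in> E \<and> (c, d) \<in> E \<and> (a, d) \<in> E \<and> (b, d) \<in> E"

definition raise :: "nat \<Rightarrow> (nat \<times> nat) set \<Rightarrow> nat \<Rightarrow> nat \<Rightarrow> nat \<Rightarrow> nat \<Rightarrow> (nat \<times> nat) set" where
  "raise N E a b c d = E - {(b, d), opp N (b, d)} \<union> {(a, c), opp N (a, c)}"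

text \<open>A segment that enters a quadrilateral without crossing its sides passes from a vertex to the
opposite one.\<close>

lemma crosses_diagonal_ac:
  assumes "a < b" "b < c" "c < d" "fst y < snd y" "cross (a, c) y"
    "\<not> cross (a, b) y" "\<not> cross (b, c) y" "\<not> cross (c, d) y" "\<not> cross (a, d) y"
  shows "y = (b, d)"
proof (cases y)
  case (Pair r s)
  have "r < s" using assms(4) Pair by simp
  consider "a < r \<and> r < c \<and> c < s" | "r < a \<and> a < s \<and> s < c"
    using assms(5) by (auto simp: cross_def Pair)
  then show ?thesis
  proof cases
    case 1
    then have "\<not> r < b" "\<not> b < r" "\<not> s < d" "\<not> d < s"
      using assms by (auto simp: cross_def Pair)
    then show ?thesis by (simp add: Pair)
  next
    case 2
    then show ?thesis using assms by (auto simp: cross_def Pair)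
  qed
qed

lemma crosses_diagonal_bd:
  assumes "a < b" "b < c" "c < d" "fst y < snd y" "cross (b, d) y"
    "\<not> cross (a, b) y" "\<not> cross (b, c) y" "\<not> cross (c, d) y" "\<not> cross (a, d) y"
  shows "y = (a, c)"
proof (cases y)
  case (Pair r s)
  have "r < s" using assms(4) Pair by simp
  consider "b < r \<and> r < d \<and> d < s" | "r < b \<and> b < s \<and> s < d"
    using assms(5) by (auto simp: cross_def Pair)
  then show ?thesis
  proof cases
    case 2
    then have "\<not> r < a" "\<not> a < r" "\<not> s < c" "\<not> c < s"
      using assms by (auto simp: cross_def Pair)
    then show ?thesis by (simp add: Pair)
  next
    case 1
    then show ?thesis using assms by (auto simp: cross_def Pair)
  qed
qed

context symmetric_triangulation
begin

text \<open>The two new diagonals cross only the two removed ones. For maximality: a pair that crosses nothing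
after the flip can have crossed only a removed diagonal, so it is the opposite diagonal of the same
quadrilateral.\<close>

lemma raise_triangulation:
  assumes Q: "up_quad N E a b c d"
  shows "symmetric_triangulation N (raise N E a b c d)"
proof -
  let ?R = "raise N E a b c d"
  have lt: "a < b" "b < c" "c < d" "N < c"
    and e: "(a, b) \<in> E" "(b, c) \<in> E" "(c, d) \<in> E" "(a, d) \<in> E" "(b, d) \<in> E"
    using Q by (simp_all add: up_quad_def)
  have rg: "1 \<le> a" "d \<le> 2 * N" using E_range[OF e(4)] by simp_all
  have ac: "(a, c) \<in> pairs N" using lt rg by (simp add: pairs_def)
  have bd: "(b, d) \<in> pairs N" using e(5) E_pairs by blast
  have E_p: "x \<in> E \<Longrightarrow> x \<in> pairs N" for x using E_pairs by blast
  have p_lt: "x \<in> pairs N \<Longrightarrow> fst x < snd x" for x by (auto simp: pairs_def)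
  have sides: "(a, b) \<in> ?R" "(b, c) \<in> ?R" "(c, d) \<in> ?R" "(a, d) \<in> ?R"
    using e lt rg by (auto simp: raise_def opp_def split: if_splits)
  have R_pairs: "?R \<subseteq> pairs N" using E_pairs ac opp_pairs by (auto simp: raise_def)
  have R_opp: "opp N x \<in> ?R" if "x \<in> ?R" for x
    using that opp_E[of x] opp_opp[OF ac] opp_opp[OF bd] opp_opp[OF E_p, of x] by (auto simp: raise_def)
  have ac_free: "\<not> cross (a, c) y" if "y \<in> E" "y \<noteq> (b, d)" for y
    using crosses_diagonal_ac[OF lt(1-3) p_lt[OF E_p[OF that(1)]]] e noncrossing that by blast
  have opp_ac_free: "\<not> cross (opp N (a, c)) y" if "y \<in> E" "y \<noteq> opp N (b, d)" for y
  proof -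
    have "opp N y \<noteq> (b, d)" using that opp_opp[OF E_p[OF that(1)]] by auto
    then have "\<not> cross (a, c) (opp N y)" using ac_free opp_E that by blast
    then show ?thesis
      using cross_opp[OF ac opp_pairs[OF E_p[OF that(1)]]] opp_opp[OF E_p[OF that(1)]] by simp
  qed
  have irrefl: "\<not> cross x x" for x by (auto simp: cross_def)
  show ?thesis
  proof
    show "2 \<le> N" "?R \<subseteq> pairs N" by (rule N_ge_2, rule R_pairs)
    have "(b, d) \<notin> boundary N" using lt E_range[OF e(1)] by (auto simp: boundary_def)
    moreover from this have "opp N (b, d) \<notin> boundary N"
      using opp_boundary opp_opp[OF bd] by metis
    ultimately show "boundary N \<subseteq> ?R" using boundary_E by (auto simp: raise_def)
    show "\<not> cross x y" if "x \<in> ?R" "y \<in> ?R" for x y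
      using that noncrossing ac_free opp_ac_free irrefl not_cross_opp[OF ac]
        cross_sym[of x y] cross_sym[of "(a, c)" "opp N (a, c)"]
      unfolding raise_def by blast
    show "opp N x \<in> ?R" if "x \<in> ?R" for x by (rule R_opp[OF that])
    fix x assume x: "x \<in> pairs N" and free: "\<And>y. y \<in> ?R \<Longrightarrow> \<not> cross x y"
    have bd_case: "z = (a, c)" if "z \<in> pairs N" "\<And>y. y \<in> ?R \<Longrightarrow> \<not> cross z y" "cross (b, d) z" for z
      using crosses_diagonal_bd[OF lt(1-3) p_lt[OF that(1)] that(3)] sides that(2) cross_sym by metis
    have opp_free: "\<not> cross (opp N x) y" if "y \<in> ?R" for y
      using free[OF R_opp[OF that]] cross_opp[OF x opp_pairs, of y] opp_opp[of y N] that R_pairs by auto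
    have cr: "cross (a, c) (b, d)" using lt by (simp add: cross_def)
    show "x \<in> ?R"
    proof (cases "x \<in> E")
      case True
      have "x \<noteq> (b, d)" using free[of "(a, c)"] cr cross_sym by (auto simp: raise_def)
      moreover have "x \<noteq> opp N (b, d)" 
        using free[of "opp N (a, c)"] cross_opp[OF ac bd] cr cross_sym[of "opp N (a, c)"] by (auto simp: raise_def)
      ultimately show ?thesis using True by (simp add: raise_def)
    next
      case False
      then obtain y where y: "y \<in> E" "cross x y" using maximal[OF x] by blast
      then consider "y = (b, d)" | "y = opp N (b, d)" using free[of y] by (auto simp: raise_def)
      then show ?thesis
      proof cases
        case 1
        then have "x = (a, c)" using bd_case[OF x free] y cross_sym by blast
        then show ?thesis by (simp add: raise_def)
      next
        case 2
        then have "cross (opp N x) (b, d)"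
          using y cross_opp[OF x opp_pairs[OF bd]] opp_opp[OF bd] by simp
        then have "opp N x = (a, c)" using bd_case[OF opp_pairs[OF x] opp_free] cross_sym by blast
        then show ?thesis using opp_opp[OF x] by (auto simp: raise_def)
      qed
    qed
  qed
qed


text \<open>The removed chords are never the left edge at a barred endpoint, since \<open>(a, d)\<close> and, if \<open>b\<close> is
unbarred, the image of \<open>(b, c)\<close> reach further left. Of the new ones, \<open>(a, c)\<close> is the left edge at \<open>c\<close>, and its image \<open>(c - N, a + N)\<close>
is the left edge at \<open>a + N\<close> if \<open>b\<close> is unbarred; if \<open>b\<close> is barred and \<open>a\<close> is not, the image of
\<open>(a, b)\<close> reaches further left.\<close>

lemma raise_left_ends:
  assumes Q: "up_quad N E a b c d"
  shows "left_end E c = b" and "left_end (raise N E a b c d) c = a"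
    and "b \<le> N \<Longrightarrow> left_end E (a + N) = d - N"
    and "b \<le> N \<Longrightarrow> left_end (raise N E a b c d) (a + N) = c - N"
    and "N < v \<Longrightarrow> v < 2 * N \<Longrightarrow> v \<noteq> c \<Longrightarrow> (b \<le> N \<Longrightarrow> v \<noteq> a + N) \<Longrightarrow>
      left_end (raise N E a b c d) v = left_end E v"
proof -
  let ?R = "raise N E a b c d"
  interpret R: symmetric_triangulation N ?R by (rule raise_triangulation[OF Q])
  have lt: "a < b" "b < c" "c < d" "N < c"
    and e: "(a, b) \<in> E" "(b, c) \<in> E" "(c, d) \<in> E" "(a, d) \<in> E" "(b, d) \<in> E"
    using Q by (simp_all add: up_quad_def)
  have rg: "1 \<le> a" "d \<le> 2 * N" using E_range[OF e(4)] by simp_all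
  have in_R: "(a, b) \<in> ?R" "(b, c) \<in> ?R" "(a, d) \<in> ?R" "(a, c) \<in> ?R"
    using e lt rg by (auto simp: raise_def opp_def split: if_splits)
  show "left_end E c = b" by (rule left_end_eq[OF e(5) lt(3) e(2)])
  show "left_end ?R c = a" by (rule R.left_end_eq[OF in_R(3) lt(3) in_R(4)])
  show "left_end E (a + N) = d - N" if "b \<le> N"
    using opp_mixed[OF e(4)] opp_mixed[OF e(5)] that lt by (intro left_end_eq[of _ "b + N"]) simp_all
  show "left_end ?R (a + N) = c - N" if "b \<le> N"
    using R.opp_mixed[OF in_R(4)] R.opp_mixed[OF in_R(2)] that lt
    by (intro R.left_end_eq[of _ "b + N"]) simp_all
  assume v: "N < v" "v < 2 * N" "v \<noteq> c" and va: "b \<le> N \<Longrightarrow> v \<noteq> a + N"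
  have "1 < v" "v \<le> 2 * N" using v N_ge_2 by simp_all
  note edge = left_edge[OF this] and R_edge = R.left_edge[OF this]
  show "left_end ?R v = left_end E v"
  proof (rule antisym)
    have "(left_end E v, v) \<noteq> (b, d)"
      using left_end_le[OF e(4)] lt by auto
    moreover have "(left_end E v, v) \<noteq> opp N (b, d)"
    proof
      assume eq: "(left_end E v, v) = opp N (b, d)"
      then have "b \<le> N" "v = b + N" "left_end E v = d - N"
        using v lt rg by (auto simp: opp_def split: if_splits)
      then show False using left_end_le[OF opp_mixed[OF e(2)]] lt by simp
    qed
    ultimately have "(left_end E v, v) \<in> ?R" using edge by (simp add: raise_def)
    then show le: "left_end ?R v \<le> left_end E v" by (rule left_end_le)
    have "(left_end ?R v, v) \<noteq> (a, c)" using v by simp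
    moreover have "(left_end ?R v, v) \<noteq> opp N (a, c)"
    proof
      assume eq: "(left_end ?R v, v) = opp N (a, c)"
      then have *: "v = a + N" "left_end ?R v = c - N"
        using v lt rg by (auto simp: opp_def split: if_splits)
      moreover have "N < b" using va * by fastforce
      moreover have "a \<le> N" using v(2) * by simp
      ultimately have "(b - N, a + N) \<in> E" using opp_mixed[OF e(1)] by simp
      then have "left_end E v \<le> b - N" using * left_end_le by simp
      then show False using le * lt \<open>N < b\<close> by linarith
    qed
    ultimately have "(left_end ?R v, v) \<in> E" using R_edge by (auto simp: raise_def)
    then show "left_end E v \<le> left_end ?R v" by (rule left_end_le)
  qed
qed

lemma raise_le:
  assumes Q: "up_quad N E a b c d" and v: "N < v" "v < 2 * N"
  shows "left_end (raise N E a b c d) v \<le> left_end E v"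
proof -
  have "a \<le> b" "c \<le> d" using Q by (simp_all add: up_quad_def)
  then have le: "a \<le> b" "c - N \<le> d - N" by simp_all
  consider "v = c" | "b \<le> N" "v = a + N" | "left_end (raise N E a b c d) v = left_end E v"
    using raise_left_ends(5)[OF Q v] by blast
  then show ?thesis
    by cases (use raise_left_ends(1-4)[OF Q] le in simp_all)
qed

lemma raise_less: "up_quad N E a b c d \<Longrightarrow> left_end (raise N E a b c d) c < left_end E c"
  using raise_left_ends(1,2)[of a b c d] by (auto simp: up_quad_def)

lemma up_quad_range: "up_quad N E a b c d \<Longrightarrow> N < c \<and> c < 2 * N"
  using E_range[of c d] by (auto simp: up_quad_def)

lemma apex_unique:
  assumes "(b, c) \<in> E" "(c, d) \<in> E" "(b, d) \<in> E" "(c, d') \<in> E" "(b, d') \<in> E"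
  shows "d = d'"
proof -
  have "b < c" "c < d" "c < d'" using E_range assms(1,2,4) by blast+
  then show ?thesis using no_cross[OF assms(3,4)] no_cross[OF assms(5,2)] nat_neq_iff by blast
qed

text \<open>The second flip lowers the left end of \<open>c'\<close>, so the first one has to lower it as well. That leaves
\<open>c' = c\<close> and, if \<open>b\<close> is unbarred, \<open>c' = a + N\<close>; a vertex is the middle of just one triangle, whose outer edge
is then the flipped diagonal or its partner.\<close>

lemma comparable_raises:
  assumes Q: "up_quad N E a b c d" and Q': "up_quad N E a' b' c' d'"
    and le: "\<And>v. N < v \<Longrightarrow> v < 2 * N \<Longrightarrow>
      left_end (raise N E a b c d) v \<le> left_end (raise N E a' b' c' d') v"
  shows "(b', d') = (b, d) \<or> (b', d') = opp N (b, d)"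
proof -
  have e: "(a, b) \<in> E" "(b, c) \<in> E" "(c, d) \<in> E" "(a, d) \<in> E" "(b, d) \<in> E"
    and e': "(b', c') \<in> E" "(c', d') \<in> E" "(b', d') \<in> E"
    and lt: "a < b" "b < c" "N < c" "c < d"
    using Q Q' by (simp_all add: up_quad_def)
  have r: "N < c'" "c' < 2 * N" using up_quad_range[OF Q'] by simp_all
  have less: "left_end (raise N E a b c d) c' < left_end E c'"
    using le[OF r] raise_less[OF Q'] by simp
  have b': "left_end E c' = b'" by (rule raise_left_ends(1)[OF Q'])
  from less consider "c' = c" | "b \<le> N" "c' = a + N"
    using raise_left_ends(5)[OF Q r] less_irrefl by metis
  then show ?thesis
  proof cases
    case 1
    then have "b' = b" using b' raise_left_ends(1)[OF Q] by simp
    then have "d' = d" using apex_unique[of b c d d'] e e' 1 by simp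
    with \<open>b' = b\<close> show ?thesis by simp
  next
    case 2
    then have "b' = d - N" using b' raise_left_ends(3)[OF Q] by simp
    moreover have "(a + N, b + N) \<in> E" "(d - N, b + N) \<in> E" "(d - N, a + N) \<in> E"
      using opp_low[OF e(1)] opp_mixed[OF e(4)] opp_mixed[OF e(5)] 2 lt by simp_all
    ultimately have "d' = b + N" using apex_unique[of "d - N" "a + N" "b + N" d'] e' 2 by simp
    then show ?thesis using 2 lt \<open>b' = d - N\<close> by (simp add: opp_def)
  qed
qed

text \<open>Let \<open>Z\<close> be the set of vertices whose left end has to be lowered. Choose \<open>c \<in> Z\<close> as large as possible,
but among the vertices with barred left end \<open>b\<close> if \<open>Z\<close> contains any, and consider the outer edge
\<open>(b, d)\<close> of the triangle with middle vertex \<open>c\<close>. If the apex on its other side were above \<open>d\<close>, then \<open>d\<close>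
would have the same left end \<open>b\<close> as \<open>c\<close> and would have to be lowered too, against the choice of \<open>c\<close>.
So the apex is some \<open>a < b\<close> and \<open>(b, d)\<close> can be flipped upwards. The flip does not overshoot: a left end
\<open>e\<close> of \<open>c\<close> in \<open>F\<close> with \<open>a < e < b\<close> would force the left end of \<open>b\<close> up in \<open>F\<close> if \<open>b\<close> is barred, and would
put \<open>e + N\<close> into \<open>Z\<close> with a barred left end if \<open>b\<close> is unbarred.\<close>

lemma raise_towards:
  assumes F: "symmetric_triangulation N F"
    and le: "\<And>v. N < v \<Longrightarrow> v < 2 * N \<Longrightarrow> left_end F v \<le> left_end E v"
    and ne: "F \<noteq> E"
  obtains a b c d where "up_quad N E a b c d"
    "\<And>v. N < v \<Longrightarrow> v < 2 * N \<Longrightarrow> left_end F v \<le> left_end (raise N E a b c d) v"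
proof -
  interpret F: symmetric_triangulation N F by (rule F)
  define Z where "Z = {v. N < v \<and> v < 2 * N \<and> left_end F v < left_end E v}"
  define Z1 where "Z1 = {v \<in> Z. N < left_end E v}"
  \<comment> \<open>Vertices with barred left end come first: lowering the left end of \<open>c\<close> below an unbarred \<open>b\<close> is safe
     only if no vertex between the images of \<open>a\<close> and \<open>b\<close> has a barred left end that must become unbarred.\<close>
  define Y where "Y = (if Z1 = {} then Z else Z1)"
  have "Z \<noteq> {}"
  proof
    assume "Z = {}"
    then have "left_end E v = left_end F v" if "N < v" "v < 2 * N" for v
      using le[OF that] that by (force simp: Z_def)
    then have "E \<subseteq> F" "F \<subseteq> E"
      using triangulation_subset_of_left_ends symmetric_triangulation_axioms F by metis+
    then show False using ne by simp
  qed
  then have "Y \<noteq> {}" by (simp add: Y_def)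
  have fin: "finite Y" by (rule finite_subset[of _ "{..2 * N}"]) (auto simp: Y_def Z1_def Z_def)
  define c where "c = Max Y"
  have "c \<in> Y" unfolding c_def using fin \<open>Y \<noteq> {}\<close> by (rule Max_in)
  have c_max: "v \<le> c" if "v \<in> Y" for v unfolding c_def using fin that by (rule Max_ge)
  have c: "N < c" "c < 2 * N" "left_end F c < left_end E c"
    using \<open>c \<in> Y\<close> by (auto simp: Y_def Z1_def Z_def split: if_splits)
  have c1: "1 < c" "c \<le> 2 * N" using c N_ge_2 by simp_all
  define b where "b = left_end E c"
  define e where "e = left_end F c"
  have bc: "(b, c) \<in> E" "b < c" using left_edge[OF c1] left_end_range[OF c1] by (simp_all add: b_def)
  have ec: "(e, c) \<in> F" "e < b" "1 \<le> e"
    using F.left_edge[OF c1] F.left_end_range[OF c1] c(3) by (simp_all add: b_def e_def)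
  obtain d where d: "c < d" "(b, d) \<in> E" "(c, d) \<in> E"
    using right_end[OF c1(1) c(2)] by (auto simp: b_def)
  have "(b, d) \<noteq> (1, 2 * N)" using ec by simp
  with d(2) obtain a where a: "a < b" "(a, b) \<in> E" "(a, d) \<in> E"
  proof (rule outer_triangle)
    fix m assume m: "d < m" "(b, m) \<in> E" "(d, m) \<in> E"
    have "d < 2 * N" using m E_range[OF m(3)] by simp
    have "left_end E d = b" using left_end_eq m d by blast
    moreover have "left_end F d < b"
    proof (rule ccontr)
      assume "\<not> left_end F d < b"
      then have "left_end F d = b" using le[of d] \<open>left_end E d = b\<close> d c \<open>d < 2 * N\<close> by simp
      then have "(b, d) \<in> F" using F.left_edge[of d] d c1 \<open>d < 2 * N\<close> by simp
      then show False using F.no_cross[OF ec(1)] ec bc d by blast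
    qed
    ultimately have "d \<in> Y" using \<open>c \<in> Y\<close> d c \<open>d < 2 * N\<close>
      by (auto simp: Y_def Z1_def Z_def b_def split: if_splits)
    then show thesis using c_max d by fastforce
  qed (use that in blast)
  have Q: "up_quad N E a b c d" using a bc d c by (simp add: up_quad_def)
  have a1: "1 \<le> a" "d \<le> 2 * N" using E_range[OF a(3)] by simp_all
  have "e \<le> a"
  proof (rule ccontr)
    assume "\<not> e \<le> a"
    show False
    proof (cases "N < b")
      case True
      have "e \<le> left_end F b" using F.left_end_ge[OF ec(1)] ec bc by blast
      moreover have "left_end F b \<le> left_end E b" using le True bc c by simp
      moreover have "left_end E b \<le> a" by (rule left_end_le[OF a(2)])
      ultimately show False using \<open>\<not> e \<le> a\<close> by simp
    next
      case False
      then have "(a + N, b + N) \<in> E" using opp_low[OF a(2)] by simp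
      then have "a + N \<le> left_end E (e + N)"
        using \<open>\<not> e \<le> a\<close> ec(2) by (intro left_end_ge[of "a + N" "b + N"]) simp_all
      moreover have "(c - N, e + N) \<in> F" using F.opp_mixed[OF ec(1)] False ec c by simp
      then have "left_end F (e + N) \<le> c - N" by (rule left_end_le)
      ultimately have "e + N \<in> Z1" using a1 c ec False by (auto simp: Z1_def Z_def)
      then have "N < b" using \<open>c \<in> Y\<close> by (auto simp: Y_def Z1_def b_def split: if_splits)
      then show False using False by simp
    qed
  qed
  \<comment> \<open>This concerns the image of the new chord. If \<open>e = a\<close>, it lies in \<open>F\<close>; otherwise \<open>F\<close> would join \<open>a\<close> to a vertex in \<open>(c, d]\<close>, crossing \<open>(e, c)\<close>.\<close>
  have opp_a: "left_end F (a + N) \<le> c - N" if "b \<le> N"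
  proof (rule ccontr)
    assume f: "\<not> left_end F (a + N) \<le> c - N"
    define f where "f = left_end F (a + N)"
    have aN: "N < a + N" "a + N < 2 * N" using a a1 that by linarith+
    have "f \<le> d - N" using le[OF aN] raise_left_ends(3)[OF Q that] by (simp add: f_def)
    have "(f, a + N) \<in> F" using F.left_edge[of "a + N"] aN N_ge_2 by (simp add: f_def)
    then have af: "(a, f + N) \<in> F"
      using F.opp_mixed[of f "a + N"] \<open>f \<le> d - N\<close> a1 by simp
    show False
    proof (cases "e = a")
      case True
      then have "(c - N, a + N) \<in> F" using F.opp_mixed[OF ec(1)] a that c by simp
      then show False using left_end_le f by blast
    next
      case False
      then show False using F.no_cross[OF ec(1) af] \<open>e \<le> a\<close> a bc f unfolding f_def by linarith
    qed
  qed
  have "left_end F v \<le> left_end (raise N E a b c d) v" if v: "N < v" "v < 2 * N" for v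
  proof -
    consider "v = c" | "b \<le> N" "v = a + N" | "left_end (raise N E a b c d) v = left_end E v"
      using raise_left_ends(5)[OF Q v] by blast
    then show ?thesis
    proof cases
      case 1
      then show ?thesis using \<open>e \<le> a\<close> raise_left_ends(2)[OF Q] by (simp add: e_def)
    next
      case 2
      then show ?thesis using opp_a raise_left_ends(4)[OF Q] by simp
    next
      case 3
      then show ?thesis using le[OF v] by simp
    qed
  qed
  with Q show ?thesis by (rule that)
qed

end

section \<open>Infima\<close>

text \<open>The pointwise maximum \<open>K\<close> of left ends satisfies every condition of a left code but the last: if
\<open>K v = p\<close> is unbarred, then \<open>p + N\<close> may have a barred left end under \<open>K\<close>. If a lower bound has an
unbarred left end \<open>p\<close> at \<open>v\<close>, then \<open>K v \<le> p\<close>, and \<open>K (p + N)\<close> is unbarred or \<open>p = N\<close>, where the last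
condition is void. Moving each unbarred \<open>K v\<close> up to the first such place is enough.
The other conditions are kept, because unbarred values stay unbarred and the admissible places
do not depend on \<open>v\<close>.\<close>

lemma infimum_of_left_ends:
  assumes N: "2 \<le> N" and A: "\<And>F. F \<in> A \<Longrightarrow> symmetric_triangulation N F"
  obtains E where "symmetric_triangulation N E"
    and "\<And>F v. F \<in> A \<Longrightarrow> N < v \<Longrightarrow> v < 2 * N \<Longrightarrow> left_end F v \<le> left_end E v"
    and "\<And>D. symmetric_triangulation N D \<Longrightarrow>
           (\<And>F v. F \<in> A \<Longrightarrow> N < v \<Longrightarrow> v < 2 * N \<Longrightarrow> left_end F v \<le> left_end D v) \<Longrightarrow>
           (\<And>v. N < v \<Longrightarrow> v < 2 * N \<Longrightarrow> left_end E v \<le> left_end D v)"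
proof -
  have "A \<subseteq> Pow (pairs N)" using A symmetric_triangulation.E_pairs by blast
  then have fin: "finite A" by (rule finite_subset) (simp add: finite_pairs)
  \<comment> \<open>The value 1, below all left ends, takes care of the empty family; it gives the top element.\<close>
  define K where "K v = Max (insert 1 ((\<lambda>F. left_end F v) ` A))" for v
  have K_le: "K v \<le> x \<longleftrightarrow> 1 \<le> x \<and> (\<forall>F\<in>A. left_end F v \<le> x)" for v x
    unfolding K_def using fin by (subst Max_le_iff) auto
  have le_K: "left_end F v \<le> K v" if "F \<in> A" for F v using K_le[of v "K v"] that by simp
  have K_1: "1 \<le> K v" for v using K_le[of v "K v"] by simp
  have code: "left_code N (left_end F)" if "F \<in> A" for F
    using symmetric_triangulation.left_code_left_end[OF A[OF that]] .
  have K_range: "K v < v" if "N < v" "v < 2 * N" for v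
  proof -
    have "left_end F v < v" if "F \<in> A" for F
      using code[OF that] \<open>N < v\<close> \<open>v < 2 * N\<close> unfolding left_code_def by blast
    then have "K v \<le> v - 1"
      unfolding K_le using that N by fastforce
    then show ?thesis using that by linarith
  qed
  have K_nested: "K v \<le> K u" if "N < u" "u < v" "v < 2 * N" "K v < u" for u v
    unfolding K_le
  proof (intro conjI ballI K_1)
    fix F assume F: "F \<in> A"
    then have "left_end F v < u" using le_K[OF F, of v] that by simp
    then have "left_end F v \<le> left_end F u"
      using code[OF F] that unfolding left_code_def by blast
    then show "left_end F v \<le> K u" using le_K[OF F, of u] by simp
  qed
  have K_opp: "K u + N \<le> v"
    if "N < u" "u < 2 * N" "N < v" "v < 2 * N" "K v + N \<le> u" "K u \<le> N" for u v
  proof -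
    have "left_end F u \<le> v - N" if F: "F \<in> A" for F
    proof -
      have "left_end F v + N \<le> u" "left_end F u \<le> N"
        using le_K[OF F, of v] le_K[OF F, of u] \<open>K v + N \<le> u\<close> \<open>K u \<le> N\<close> by simp_all
      then have "left_end F u + N \<le> v"
        using code[OF F] \<open>N < u\<close> \<open>u < 2 * N\<close> \<open>N < v\<close> \<open>v < 2 * N\<close> unfolding left_code_def by blast
      then show ?thesis by simp
    qed
    then have "K u \<le> v - N" unfolding K_le using that by simp
    then show ?thesis using that by simp
  qed
  define P where "P v p \<longleftrightarrow> K v \<le> p \<and> (p = N \<or> p < N \<and> K (p + N) \<le> N)" for v p
  define f where "f v = (if v = 2 * N then 1 else if K v \<le> N then LEAST p. P v p else K v)" for v
  have P_f: "P v (f v)" if "v < 2 * N" "K v \<le> N" for v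
  proof -
    have "P v N" using that by (simp add: P_def)
    then have "P v (LEAST p. P v p)" by (rule LeastI)
    then show ?thesis using that by (simp add: f_def)
  qed
  have f_le: "f v \<le> p" if "v < 2 * N" "K v \<le> N" "P v p" for v p
    using that Least_le[of "P v" p] by (simp add: f_def)
  have f_K: "f v = K v" if "v < 2 * N" "\<not> K v \<le> N" for v using that by (simp add: f_def)
  have K_le_f: "K v \<le> f v" if "v < 2 * N" for v
    using P_f[OF that] f_K[OF that] by (cases "K v \<le> N") (auto simp: P_def)
  have f_N: "f v \<le> N \<longleftrightarrow> K v \<le> N" if "v < 2 * N" for v
    using P_f[OF that] f_K[OF that] by (cases "K v \<le> N") (auto simp: P_def)
  have f_range: "1 \<le> f v \<and> f v < v" if v: "N < v" "v < 2 * N" for v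
    using K_1[of v] K_le_f[OF v(2)] f_N[OF v(2)] f_K[OF v(2)] K_range[OF v] v
    by (cases "K v \<le> N") auto
  have f_mixed: "f (f v + N) \<le> N" if v: "N < v" "v < 2 * N" "f v < N" for v
  proof -
    have "K v \<le> N" using f_N[OF v(2)] v(3) by simp
    then have "K (f v + N) \<le> N" using P_f[OF v(2)] v(3) by (simp add: P_def)
    then show ?thesis using f_N[of "f v + N"] v(3) by simp
  qed
  have f_nested: "f v \<le> f u" if u: "N < u" "u < v" "v < 2 * N" "f v < u" for u v
  proof (cases "K v \<le> N")
    case True
    have "K v < u" using K_le_f[OF u(3)] u(4) by simp
    then have K: "K v \<le> K u" using K_nested u by blast
    have "u < 2 * N" using u by simp
    show ?thesis
    proof (cases "K u \<le> N")
      case True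
      then have "P u (f u)" using P_f \<open>u < 2 * N\<close> by blast
      then have "P v (f u)" using K by (auto simp: P_def)
      then show ?thesis using f_le u(3) \<open>K v \<le> N\<close> by blast
    next
      case False
      then have "f v \<le> N" "N < f u" using f_K[of u] f_N[of v] True u(3) \<open>u < 2 * N\<close> by simp_all
      then show ?thesis by simp
    qed
  next
    case False
    then have "f v = K v" by (rule f_K[OF u(3)])
    moreover from this have "K v \<le> K u" using K_nested[of u v] u by simp
    moreover have "K u \<le> f u" using K_le_f[of u] u by simp
    ultimately show ?thesis by simp
  qed
  have f_opp: "f u + N \<le> v"
    if u: "N < u" "u < 2 * N" and v: "N < v" "v < 2 * N" "f v + N \<le> u" "f u \<le> N" for u v
  proof -
    have K: "K v + N \<le> u" using K_le_f[OF v(2)] v(3) by simp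
    have "f v \<le> N" using u(2) v(3) by simp
    then have "K u \<le> N" "K v \<le> N" using f_N[OF u(2)] f_N[OF v(2)] v(4) by simp_all
    then have "K u + N \<le> v" using K_opp u v K by blast
    then have "P u (v - N)" using \<open>K v \<le> N\<close> v(1,2) unfolding P_def by auto
    then have "f u \<le> v - N" using f_le u \<open>K u \<le> N\<close> by blast
    then show ?thesis using v(1) by simp
  qed
  have "\<forall>v. N < v \<and> v < 2 * N \<longrightarrow> 1 \<le> f v \<and> f v < v"
    using f_range by blast
  moreover have "\<forall>u v. N < u \<and> u < v \<and> v < 2 * N \<and> f v < u \<longrightarrow> f v \<le> f u"
    using f_nested by blast
  moreover have "\<forall>u v. N < u \<and> u < 2 * N \<and> N < v \<and> v < 2 * N \<and> f v + N \<le> u \<and> f u \<le> N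
    \<longrightarrow> f u + N \<le> v"
    using f_opp by blast
  moreover have "\<forall>v. N < v \<and> v < 2 * N \<and> f v < N \<longrightarrow> f (f v + N) \<le> N"
    using f_mixed by blast
  moreover have "f (2 * N) = 1" by (simp add: f_def)
  ultimately have "left_code N f" unfolding left_code_def by (intro conjI)
  then obtain E where E: "symmetric_triangulation N E"
    and left_E: "\<And>v. N < v \<Longrightarrow> v < 2 * N \<Longrightarrow> left_end E v = f v"
    using triangulation_of_left_code[OF N] by metis
  show ?thesis
  proof (rule that[OF E])
    show "left_end F v \<le> left_end E v" if "F \<in> A" "N < v" "v < 2 * N" for F v
      using le_K[OF that(1), of v] K_le_f[OF that(3)] left_E[OF that(2,3)] by simp
  next
    fix D v assume D: "symmetric_triangulation N D" and v: "N < v" "v < 2 * N"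
      and le: "\<And>F v. F \<in> A \<Longrightarrow> N < v \<Longrightarrow> v < 2 * N \<Longrightarrow> left_end F v \<le> left_end D v"
    interpret D: symmetric_triangulation N D by (rule D)
    have K_D: "K u \<le> left_end D u" if "N < u" "u < 2 * N" for u
      unfolding K_le using le[OF _ that] D.left_end_range[of u] that N by simp
    have "f v \<le> left_end D v"
    proof (cases "left_end D v \<le> N")
      case True
      then have "K v \<le> N" using K_D[OF v] by simp
      have "left_end D v = N \<or> left_end D v < N \<and> K (left_end D v + N) \<le> N"
      proof (cases "left_end D v < N")
        case True
        then have "left_end D (left_end D v + N) \<le> N"
          using D.left_code_left_end v unfolding left_code_def by blast
        moreover have "N < left_end D v + N" using D.left_end_range[of v] v N by simp
        ultimately have "K (left_end D v + N) \<le> N" using K_D[of "left_end D v + N"] True by simp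
        then show ?thesis using True by simp
      qed (use True in simp)
      then have "P v (left_end D v)" using K_D[OF v] by (simp add: P_def)
      then show ?thesis using f_le v \<open>K v \<le> N\<close> by blast
    next
      case False
      then show ?thesis using f_N[OF v(2)] f_K[OF v(2)] K_D[OF v] by (cases "K v \<le> N") auto
    qed
    then show "left_end E v \<le> left_end D v" using left_E[OF v] by simp
  qed
qed

section \<open>Vertices, segments and positions\<close>

definition vtx :: "nat \<Rightarrow> nat \<Rightarrow> vertex" where
  "vtx n p = (if p \<le> n + 1 then Unbarred p else Barred (p - (n + 1)))"

definition seg :: "nat \<Rightarrow> nat \<times> nat \<Rightarrow> vertex set" where
  "seg n x = {vtx n (fst x), vtx n (snd x)}"

text \<open>Sides of the polygon are included, so that the three sides of a triangle are treated alike.\<close>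

definition edges :: "nat \<Rightarrow> vertex set set \<Rightarrow> (nat \<times> nat) set" where
  "edges n S = {x \<in> pairs (n + 1). seg n x \<in> S \<union> sides n}"

lemma pos_vtx: "1 \<le> p \<Longrightarrow> pos n (vtx n p) = p"
  by (auto simp: pos_def vtx_def)

lemma vtx_pos: "v \<in> vertices n \<Longrightarrow> vtx n (pos n v) = v"
  by (cases v) (auto simp: pos_def vtx_def vertices_def)

lemma pos_range: "v \<in> vertices n \<Longrightarrow> 1 \<le> pos n v \<and> pos n v \<le> 2 * (n + 1)"
  by (cases v) (auto simp: pos_def vertices_def)

lemma vtx_vertices: "1 \<le> p \<Longrightarrow> p \<le> 2 * (n + 1) \<Longrightarrow> vtx n p \<in> vertices n"
  by (auto simp: vtx_def vertices_def)

lemma vtx_eq_iff: "1 \<le> p \<Longrightarrow> 1 \<le> q \<Longrightarrow> vtx n p = vtx n q \<longleftrightarrow> p = q"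
  by (metis pos_vtx)

lemma pos_eq_iff: "u \<in> vertices n \<Longrightarrow> v \<in> vertices n \<Longrightarrow> pos n u = pos n v \<longleftrightarrow> u = v"
  by (metis vtx_pos)

lemma seg_eq_iff: "x \<in> pairs N \<Longrightarrow> y \<in> pairs N \<Longrightarrow> seg n x = seg n y \<longleftrightarrow> x = y"
  by (cases x; cases y) (auto simp: seg_def pairs_def doubleton_eq_iff vtx_eq_iff)

lemma bar_bar: "bar (bar v) = v"
  by (cases v) simp_all

lemma bar_image_bar_image: "bar ` bar ` C = C"
  by (simp add: image_image bar_bar)

lemma bar_vertices: "v \<in> vertices n \<Longrightarrow> bar v \<in> vertices n"
  by (cases v) (simp_all add: vertices_def)

lemma bar_seg: "x \<in> pairs (n + 1) \<Longrightarrow> bar ` seg n x = seg n (opp (n + 1) x)"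
  by (cases x) (auto simp: seg_def pairs_def opp_def vtx_def)

lemma pair_of_vertices:
  assumes "u \<in> vertices n" "v \<in> vertices n" "u \<noteq> v"
  obtains x where "x \<in> pairs (n + 1)" "{u, v} = seg n x"
    "{fst x, snd x} = {pos n u, pos n v}"
proof (cases "pos n u < pos n v")
  case True
  then show ?thesis using that[of "(pos n u, pos n v)"] assms pos_range[of u n] pos_range[of v n]
    by (simp add: seg_def pairs_def vtx_pos)
next
  case False
  then have "pos n v < pos n u" using assms pos_eq_iff[of u n v] by simp
  then show ?thesis using that[of "(pos n v, pos n u)"] assms pos_range[of u n] pos_range[of v n]
    by (simp add: seg_def pairs_def vtx_pos insert_commute)
qed

lemma crosses_seg:
  assumes "x \<in> pairs (n + 1)" "y \<in> pairs (n + 1)"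
  shows "crosses n (seg n x) (seg n y) \<longleftrightarrow> cross x y"
proof
  have ends: "fst z = pos n u \<and> snd z = pos n v" if "seg n z = {u, v}" "z \<in> pairs (n + 1)"
    "pos n u < pos n v" for z u v
  proof -
    have z: "1 \<le> fst z" "fst z < snd z" using that(2) by (auto simp: pairs_def)
    from that(1) consider "vtx n (fst z) = u" "vtx n (snd z) = v" | "vtx n (fst z) = v" "vtx n (snd z) = u"
      unfolding seg_def by (auto simp: doubleton_eq_iff)
    then show ?thesis
    proof cases
      case 1
      then show ?thesis using z pos_vtx[of "fst z" n] pos_vtx[of "snd z" n] by simp
    next
      case 2
      then show ?thesis using z pos_vtx[of "fst z" n] pos_vtx[of "snd z" n] that(3) by simp
    qed
  qed
  assume "crosses n (seg n x) (seg n y)"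
  then obtain a b c d where
    s: "seg n x = {a, b} \<and> seg n y = {c, d} \<or> seg n x = {c, d} \<and> seg n y = {a, b}"
    and o: "pos n a < pos n c" "pos n c < pos n b" "pos n b < pos n d"
    unfolding crosses_def by blast
  have ab: "pos n a < pos n b" and cd: "pos n c < pos n d" using o by linarith+
  from s show "cross x y"
  proof (elim disjE conjE)
    assume "seg n x = {a, b}" "seg n y = {c, d}"
    then show ?thesis using ends[OF _ assms(1) ab] ends[OF _ assms(2) cd] o by (simp add: cross_def)
  next
    assume "seg n x = {c, d}" "seg n y = {a, b}"
    then show ?thesis using ends[OF _ assms(2) ab] ends[OF _ assms(1) cd] o by (simp add: cross_def)
  qed
next
  assume c: "cross x y"
  have r: "1 \<le> fst x" "1 \<le> fst y" "fst x < snd x" "fst y < snd y"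
    using assms by (auto simp: pairs_def)
  then have p: "pos n (vtx n (fst x)) = fst x" "pos n (vtx n (snd x)) = snd x"
    "pos n (vtx n (fst y)) = fst y" "pos n (vtx n (snd y)) = snd y"
    using pos_vtx by simp_all
  from c consider "fst x < fst y" "fst y < snd x" "snd x < snd y"
    | "fst y < fst x" "fst x < snd y" "snd y < snd x" by (auto simp: cross_def)
  then show "crosses n (seg n x) (seg n y)"
  proof cases
    case 1
    then show ?thesis unfolding crosses_def seg_def
      by (intro exI[of _ "vtx n (fst x)"] exI[of _ "vtx n (snd x)"] exI[of _ "vtx n (fst y)"] exI[of _ "vtx n (snd y)"])
        (simp add: p)
  next
    case 2
    then show ?thesis unfolding crosses_def seg_def
      by (intro exI[of _ "vtx n (fst y)"] exI[of _ "vtx n (snd y)"] exI[of _ "vtx n (fst x)"] exI[of _ "vtx n (snd x)"])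
        (simp add: p)
  qed
qed

lemma crosses_distinct: "crosses n C {c, d} \<Longrightarrow> c \<noteq> d"
  by (auto simp: crosses_def doubleton_eq_iff singleton_insert_inj_eq')

lemma adjacent_vtx:
  assumes "(p, q) \<in> pairs (n + 1)"
  shows "adjacent n (vtx n p) (vtx n q) \<longleftrightarrow> (p, q) \<in> boundary (n + 1)"
proof -
  have r: "1 \<le> p" "p < q" "q \<le> 2 * n + 2" using assms by (auto simp: pairs_def)
  have "(p + 1) mod (2 * n + 2) = q mod (2 * n + 2) \<longleftrightarrow> q = p + 1"
    using r by (cases "p + 1 = 2 * n + 2"; cases "q = 2 * n + 2") auto
  moreover have "(q + 1) mod (2 * n + 2) = p mod (2 * n + 2) \<longleftrightarrow> p = 1 \<and> q = 2 * n + 2"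
    using r by (cases "q = 2 * n + 2") (auto simp: mod_Suc)
  ultimately show ?thesis using r by (auto simp: adjacent_def boundary_def pos_vtx)
qed

lemma adjacent_commute: "adjacent n u v \<longleftrightarrow> adjacent n v u"
  by (auto simp: adjacent_def)

text \<open>The common shape of the definitions of sides and chords.\<close>

lemma vertex_pairs:
  "{{u, v} | u v. u \<in> vertices n \<and> v \<in> vertices n \<and> u \<noteq> v \<and> P u v} = seg n ` {x \<in> pairs (n + 1). P (vtx n (fst x)) (vtx n (snd x))}"
  if "\<And>u v. P u v \<longleftrightarrow> P v u"
proof (intro equalityI subsetI)
  fix C assume "C \<in> {{u, v} | u v. u \<in> vertices n \<and> v \<in> vertices n \<and> u \<noteq> v \<and> P u v}"
  then obtain u v where uv: "C = {u, v}" "u \<in> vertices n" "v \<in> vertices n" "u \<noteq> v" "P u v" by blast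
  then obtain x where x: "x \<in> pairs (n + 1)" "{u, v} = seg n x" using pair_of_vertices by blast
  then have "P (vtx n (fst x)) (vtx n (snd x))"
    using uv(5) that[of u v] by (auto simp: seg_def doubleton_eq_iff)
  with x uv(1) show "C \<in> seg n ` {x \<in> pairs (n + 1). P (vtx n (fst x)) (vtx n (snd x))}" by blast
next
  fix C assume "C \<in> seg n ` {x \<in> pairs (n + 1). P (vtx n (fst x)) (vtx n (snd x))}"
  then obtain p q where pq: "C = seg n (p, q)" "(p, q) \<in> pairs (n + 1)" "P (vtx n p) (vtx n q)" by auto
  then have "vtx n p \<in> vertices n" "vtx n q \<in> vertices n" "vtx n p \<noteq> vtx n q"
    by (auto simp: pairs_def vtx_eq_iff intro!: vtx_vertices)
  with pq show "C \<in> {{u, v} | u v. u \<in> vertices n \<and> v \<in> vertices n \<and> u \<noteq> v \<and> P u v}"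
    by (auto simp: seg_def)
qed

lemma sides_eq: "sides n = seg n ` boundary (n + 1)"
proof -
  have "sides n = seg n ` {x \<in> pairs (n + 1). adjacent n (vtx n (fst x)) (vtx n (snd x))}"
    unfolding sides_def by (rule vertex_pairs) (rule adjacent_commute)
  moreover have "{x \<in> pairs (n + 1). adjacent n (vtx n (fst x)) (vtx n (snd x))} = boundary (n + 1)"
    using adjacent_vtx boundary_pairs by fastforce
  ultimately show ?thesis by simp
qed

lemma chords_eq: "chords n = seg n ` (pairs (n + 1) - boundary (n + 1))"
proof -
  have "chords n = seg n ` {x \<in> pairs (n + 1). \<not> adjacent n (vtx n (fst x)) (vtx n (snd x))}"
    unfolding chords_def by (rule vertex_pairs) (simp add: adjacent_commute)
  moreover have "{x \<in> pairs (n + 1). \<not> adjacent n (vtx n (fst x)) (vtx n (snd x))} = pairs (n + 1) - boundary (n + 1)"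
    using adjacent_vtx by fastforce
  ultimately show ?thesis by simp
qed

lemma seg_in_sides: "x \<in> pairs (n + 1) \<Longrightarrow> seg n x \<in> sides n \<longleftrightarrow> x \<in> boundary (n + 1)"
  using seg_eq_iff boundary_pairs unfolding sides_eq by blast

lemma chords_of_edges:
  assumes "S \<subseteq> chords n"
  shows "S = seg n ` (edges n S - boundary (n + 1))"
  using assms seg_in_sides unfolding edges_def chords_eq by blast

lemma edges_of_chords:
  assumes "boundary (n + 1) \<subseteq> E" "E \<subseteq> pairs (n + 1)"
  shows "edges n (seg n ` (E - boundary (n + 1))) = E"
  using assms seg_eq_iff[of _ "n + 1" _ n] seg_in_sides unfolding edges_def by blast

section \<open>Regions\<close>

text \<open>Sides and diagonals of the polygon spanned by \<open>P\<close>.\<close>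

definition inside :: "nat \<Rightarrow> nat set \<Rightarrow> (nat \<times> nat) set" where
  "inside N P = {x \<in> pairs N. fst x \<in> P \<and> snd x \<in> P}"

lemma crosses_inside:
  assumes F: "F \<subseteq> vertices n" and x: "x \<in> pairs (n + 1)"
  shows "(\<exists>c\<in>F. \<exists>d\<in>F. crosses n (seg n x) {c, d}) \<longleftrightarrow> (\<exists>y\<in>inside (n + 1) (pos n ` F). cross x y)"
proof
  assume "\<exists>c\<in>F. \<exists>d\<in>F. crosses n (seg n x) {c, d}"
  then obtain c d where cd: "c \<in> F" "d \<in> F" "crosses n (seg n x) {c, d}" by blast
  then have "c \<noteq> d" using crosses_distinct by blast
  then obtain y where y: "y \<in> pairs (n + 1)" "{c, d} = seg n y" "{fst y, snd y} = {pos n c, pos n d}"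
    using pair_of_vertices[of c n d] cd F by blast
  then have "y \<in> inside (n + 1) (pos n ` F)" using cd by (auto simp: inside_def doubleton_eq_iff)
  moreover have "cross x y" using crosses_seg[OF x y(1)] cd(3) y(2) by simp
  ultimately show "\<exists>y\<in>inside (n + 1) (pos n ` F). cross x y" by blast
next
  assume "\<exists>y\<in>inside (n + 1) (pos n ` F). cross x y"
  then obtain y where y: "y \<in> pairs (n + 1)" "fst y \<in> pos n ` F" "snd y \<in> pos n ` F" "cross x y"
    unfolding inside_def by blast
  then have "vtx n (fst y) \<in> F" "vtx n (snd y) \<in> F" using F vtx_pos by (auto simp: subset_iff)
  moreover have "crosses n (seg n x) (seg n y)" using crosses_seg[OF x y(1)] y(4) by simp
  ultimately show "\<exists>c\<in>F. \<exists>d\<in>F. crosses n (seg n x) {c, d}" unfolding seg_def by blast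
qed

lemma region_iff:
  assumes F: "F \<subseteq> vertices n"
  shows "region n S F \<longleftrightarrow> 3 \<le> card F \<and>
    (\<forall>x\<in>inside (n + 1) (pos n ` F).
       x \<in> edges n S \<longleftrightarrow> \<not> (\<exists>y\<in>inside (n + 1) (pos n ` F). cross x y))"
proof -
  let ?P = "pos n ` F"
  have "(\<forall>a\<in>F. \<forall>b\<in>F. a \<noteq> b \<longrightarrow>
        ({a, b} \<in> S \<union> sides n \<longleftrightarrow> \<not> (\<exists>c\<in>F. \<exists>d\<in>F. crosses n {a, b} {c, d}))) \<longleftrightarrow>
    (\<forall>x\<in>inside (n + 1) ?P. x \<in> edges n S \<longleftrightarrow> \<not> (\<exists>y\<in>inside (n + 1) ?P. cross x y))" (is "?L \<longleftrightarrow> ?R")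
  proof (rule iffI; intro ballI impI)
    fix x assume L: ?L and x: "x \<in> inside (n + 1) ?P"
    then have x': "x \<in> pairs (n + 1)" by (simp add: inside_def)
    have "vtx n (fst x) \<in> F" "vtx n (snd x) \<in> F" using x F vtx_pos by (auto simp: inside_def subset_iff)
    moreover have "vtx n (fst x) \<noteq> vtx n (snd x)" using x' by (auto simp: pairs_def vtx_eq_iff)
    ultimately have "seg n x \<in> S \<union> sides n \<longleftrightarrow> \<not> (\<exists>c\<in>F. \<exists>d\<in>F. crosses n (seg n x) {c, d})"
      using L unfolding seg_def by blast
    then show "x \<in> edges n S \<longleftrightarrow> \<not> (\<exists>y\<in>inside (n + 1) ?P. cross x y)"
      using crosses_inside[OF F x'] x' by (simp add: edges_def)
  next
    fix a b assume R: ?R and ab: "a \<in> F" "b \<in> F" "a \<noteq> b"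
    then obtain x where x: "x \<in> pairs (n + 1)" "{a, b} = seg n x" "{fst x, snd x} = {pos n a, pos n b}"
      using pair_of_vertices[of a n b] F by blast
    then have "x \<in> inside (n + 1) ?P" using ab by (auto simp: inside_def doubleton_eq_iff)
    then have "x \<in> edges n S \<longleftrightarrow> \<not> (\<exists>y\<in>inside (n + 1) ?P. cross x y)" using R by blast
    moreover have "x \<in> edges n S \<longleftrightarrow> seg n x \<in> S \<union> sides n" using x(1) by (simp add: edges_def)
    ultimately show "{a, b} \<in> S \<union> sides n \<longleftrightarrow> \<not> (\<exists>c\<in>F. \<exists>d\<in>F. crosses n {a, b} {c, d})"
      using crosses_inside[OF F x(1)] unfolding x(2) by blast
  qed
  then show ?thesis using F unfolding region_def by blast
qed

text \<open>Cutting a polygon along \<open>(p, q)\<close> does not turn a diagonal of one of the two parts, other than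
\<open>(p, q)\<close>, into a side: if it is crossed by a segment \<open>(c, d)\<close> that leaves this part, then it is also
crossed by a segment joining \<open>p\<close> or \<open>q\<close> to the endpoint of \<open>(c, d)\<close> that stays. This lemma treats
the part between \<open>p\<close> and \<open>q\<close>, the next one the part outside.\<close>

lemma cross_to_part_between:
  assumes "cross (a, b) (c, d)" "a < b" "c < d" "p \<le> a" "b \<le> q" "(a, b) \<noteq> (p, q)"
  obtains y where "cross (a, b) y" "fst y < snd y" "{fst y, snd y} \<subseteq> {p, q} \<union> {c, d} \<inter> {p..q}"
proof -
  have ne: "p < a \<or> b < q" using assms(4-6) by auto
  from assms(1) consider "a < c" "c < b" "b < d" | "c < a" "a < d" "d < b" by (auto simp: cross_def)
  then show thesis
  proof cases
    case 1
    from ne consider "d \<le> q" | "b < q" "q < d" | "p < a" by linarith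
    then show thesis
    proof cases
      case _: 1
      show thesis by (rule that[of "(c, d)"]) (use 1 \<open>d \<le> q\<close> assms(4) in \<open>auto simp: cross_def\<close>)
    next
      case _: 2
      show thesis by (rule that[of "(c, q)"]) (use 1 \<open>b < q\<close> assms(4) in \<open>auto simp: cross_def\<close>)
    next
      case _: 3
      show thesis by (rule that[of "(p, c)"]) (use 1 \<open>p < a\<close> assms(5) in \<open>auto simp: cross_def\<close>)
    qed
  next
    case 2
    from ne consider "p \<le> c" | "p < a" "c < p" | "b < q" by linarith
    then show thesis
    proof cases
      case _: 1
      show thesis by (rule that[of "(c, d)"]) (use 2 \<open>p \<le> c\<close> assms(5) in \<open>auto simp: cross_def\<close>)
    next
      case _: 2
      show thesis by (rule that[of "(p, d)"]) (use 2 \<open>p < a\<close> assms(5) in \<open>auto simp: cross_def\<close>)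
    next
      case _: 3
      show thesis by (rule that[of "(d, q)"]) (use 2 \<open>b < q\<close> assms(4) in \<open>auto simp: cross_def\<close>)
    qed
  qed
qed

lemma cross_to_part_outside:
  assumes "cross (a, b) (c, d)" "a < b" "c < d" "p < q" "a \<le> p \<or> q \<le> a" "b \<le> p \<or> q \<le> b" "(a, b) \<noteq> (p, q)"
  obtains y where "cross (a, b) y" "fst y < snd y" "{fst y, snd y} \<subseteq> {p, q} \<union> {c, d} \<inter> ({..p} \<union> {q..})"
proof -
  have ne: "a \<noteq> p \<or> b \<noteq> q" using assms(7) by auto
  from assms(1) consider "a < c" "c < b" "b < d" | "c < a" "a < d" "d < b" by (auto simp: cross_def)
  then show thesis
  proof cases
    case 1
    then consider (both) "c \<le> p \<or> q \<le> c" "d \<le> p \<or> q \<le> d" | (q) "p < c" "c < q" "q < b" | (p) "p < c" "c < q" "b = q" "a < p"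
      | (d) "p < d" "d < q"
      using assms(5,6) ne by linarith
    then show thesis
    proof cases
      case both
      then show thesis by (intro that[of "(c, d)"]) (use 1 in \<open>auto simp: cross_def\<close>)
    next
      case q
      then show thesis by (intro that[of "(q, d)"]) (use 1 assms(5) in \<open>auto simp: cross_def\<close>)
    next
      case p
      then show thesis by (intro that[of "(p, d)"]) (use 1 in \<open>auto simp: cross_def\<close>)
    next
      case d
      then show thesis by (intro that[of "(c, q)"]) (use 1 assms(6) in \<open>auto simp: cross_def\<close>)
    qed
  next
    case 2
    then consider (both) "c \<le> p \<or> q \<le> c" "d \<le> p \<or> q \<le> d" | (p) "p < d" "d < q" "a < p" | (q) "p < d" "d < q" "a = p" "q < b"
      | (c) "p < c" "c < q"
      using assms(5,6) ne by linarith
    then show thesis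
    proof cases
      case both
      then show thesis by (intro that[of "(c, d)"]) (use 2 in \<open>auto simp: cross_def\<close>)
    next
      case p
      then show thesis by (intro that[of "(c, p)"]) (use 2 assms(6) in \<open>auto simp: cross_def\<close>)
    next
      case q
      then show thesis by (intro that[of "(c, q)"]) (use 2 in \<open>auto simp: cross_def\<close>)
    next
      case c
      then show thesis by (intro that[of "(p, d)"]) (use 2 assms(5) in \<open>auto simp: cross_def\<close>)
    qed
  qed
qed

lemma insideI: "p \<in> P \<Longrightarrow> q \<in> P \<Longrightarrow> p < q \<Longrightarrow> P \<subseteq> {1..2 * N} \<Longrightarrow> (p, q) \<in> inside N P"
  by (auto simp: inside_def pairs_def)

text \<open>A triangulation with all regions triangles is maximal: a missing diagonal \<open>x\<close> that crosses no edge is a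
diagonal of some region. That region is a vertex set \<open>P\<close> of least size such that \<open>x\<close> is a diagonal
of \<open>P\<close> and all sides of \<open>P\<close> are edges. The whole polygon is such a set, and a least one has no diagonal
in \<open>E\<close>, since cutting along it would leave a smaller part containing \<open>x\<close>.\<close>

lemma region_around:
  assumes E: "E \<subseteq> pairs N" "boundary N \<subseteq> E" 
    and x: "x \<in> pairs N" "x \<notin> E" "\<And>y. y \<in> E \<Longrightarrow> \<not> cross x y"
  obtains P where "P \<subseteq> {1..2 * N}" "\<exists>u\<in>inside N P. \<exists>y\<in>inside N P. cross u y"
    "\<And>u. u \<in> inside N P \<Longrightarrow> u \<in> E \<longleftrightarrow> \<not> (\<exists>y\<in>inside N P. cross u y)"
proof -
  define good where "good P \<longleftrightarrow> P \<subseteq> {1..2 * N} \<and> x \<in> inside N P \<and> (\<exists>y\<in>inside N P. cross x y) \<and>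
    (\<forall>u\<in>inside N P. u \<in> E \<or> (\<exists>y\<in>inside N P. cross u y))" for P
  have inner: "\<exists>y\<in>inside N {1..2 * N}. cross u y" if u: "u \<in> pairs N" "u \<notin> boundary N" for u
  proof (cases u)
    case (Pair a b)
    then have ab: "1 \<le> a" "a + 1 < b" "b \<le> 2 * N" "a \<noteq> 1 \<or> b \<noteq> 2 * N"
      using u by (auto simp: pairs_def boundary_def)
    show ?thesis
    proof (cases "b < 2 * N")
      case True
      then show ?thesis using ab Pair
        by (intro bexI[of _ "(a + 1, b + 1)"] insideI) (auto simp: cross_def)
    next
      case False
      then show ?thesis using ab Pair
        by (intro bexI[of _ "(a - 1, a + 1)"] insideI) (auto simp: cross_def)
    qed
  qed
  have "good {1..2 * N}"
  proof -
    have all: "inside N {1..2 * N} = pairs N" by (auto simp: inside_def pairs_def)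
    show ?thesis unfolding good_def all using inner[unfolded all] x(1,2) E(2) by blast
  qed
  then obtain P where P: "good P" and least: "\<And>P'. good P' \<Longrightarrow> card P \<le> card P'"
    using ex_has_least_nat[of good _ card] by blast
  have PN: "P \<subseteq> {1..2 * N}" and xP: "x \<in> inside N P" and closed: "\<And>u. u \<in> inside N P \<Longrightarrow> u \<in> E \<or> (\<exists>y\<in>inside N P. cross u y)"
    and cx: "\<exists>y\<in>inside N P. cross x y"
    using P unfolding good_def by blast+
  have fin: "finite P" using PN by (rule finite_subset) simp
  show thesis
  proof (rule that[OF PN])
    show "\<exists>u\<in>inside N P. \<exists>y\<in>inside N P. cross u y" using xP cx by blast
    fix z assume z: "z \<in> inside N P"
    have False if zE: "z \<in> E" and y: "y \<in> inside N P" "cross z y" for y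
    proof -
      obtain p q c d a b where zyx: "z = (p, q)" "y = (c, d)" "x = (a, b)" by force
      have pq: "p < q" "p \<in> P" "q \<in> P" and cd: "c < d" "c \<in> P" "d \<in> P" and ab: "a < b" "a \<in> P" "b \<in> P"
        using z y xP by (auto simp: inside_def pairs_def zyx)
      have smaller: False if A: "p \<in> A" "q \<in> A" "a \<in> A" "b \<in> A" and notin: "c \<notin> A \<or> d \<notin> A"
        and reroute: "\<And>u v. u \<in> inside N (P \<inter> A) \<Longrightarrow> u \<noteq> (p, q) \<Longrightarrow> v \<in> inside N P \<Longrightarrow> cross u v \<Longrightarrow>
            \<exists>v\<in>inside N (P \<inter> A). cross u v" for A
      proof -
        have xA: "x \<in> inside N (P \<inter> A)" using xP A(3,4) by (simp add: inside_def zyx(3))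
        have "x \<noteq> (p, q)" using x(2) zE zyx(1) by metis
        then have 1: "\<exists>y\<in>inside N (P \<inter> A). cross x y" using reroute[OF xA] cx by metis
        have 2: "u \<in> E \<or> (\<exists>y\<in>inside N (P \<inter> A). cross u y)" if u: "u \<in> inside N (P \<inter> A)" for u
        proof (cases "u = (p, q) \<or> u \<in> E")
          case False
          have "u \<in> inside N P" using u by (simp add: inside_def)
          then obtain v where "v \<in> inside N P" "cross u v" using closed False by metis
          then show ?thesis using reroute[OF u] False by metis
        qed (use zE zyx(1) in metis)
        have "P \<inter> A \<subseteq> {1..2 * N}" using PN by (rule le_infI1)
        with xA 1 2 have "good (P \<inter> A)" unfolding good_def by simp
        then have "card P \<le> card (P \<inter> A)" by (rule least)
        moreover have "card (P \<inter> A) < card P"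
          by (rule psubset_card_mono[OF fin]) (use notin cd(2,3) in blast)
        ultimately show False by simp
      qed
      from y(2) have cross: "p < c \<and> c < q \<and> q < d \<or> c < p \<and> p < d \<and> d < q"
        by (auto simp: cross_def zyx)
      have "\<not> (a < p \<and> p < b \<and> b < q)" "\<not> (p < a \<and> a < q \<and> q < b)"
        using x(3)[OF zE] by (simp_all add: cross_def zyx)
      then consider "p \<le> a" "b \<le> q" | "a \<le> p \<or> q \<le> a" "b \<le> p \<or> q \<le> b"
        using ab(1) pq(1) by linarith
      then show False
      proof cases
        case 1
        let ?A = "{p..q}"
        have "\<exists>v\<in>inside N (P \<inter> ?A). cross u v"
          if u: "u \<in> inside N (P \<inter> ?A)" "u \<noteq> (p, q)" and v: "v \<in> inside N P" "cross u v" for u v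
        proof -
          obtain u1 u2 v1 v2 where uv: "u = (u1, u2)" "v = (v1, v2)" by force
          have u': "u1 < u2" "p \<le> u1" "u2 \<le> q"
            using u(1) by (simp_all add: inside_def pairs_def uv)
          have v': "v1 < v2" "v1 \<in> P" "v2 \<in> P" using v(1) by (simp_all add: inside_def pairs_def uv)
          obtain y where y: "cross u y" "fst y < snd y" "{fst y, snd y} \<subseteq> {p, q} \<union> {v1, v2} \<inter> ?A"
            using cross_to_part_between[of u1 u2 v1 v2 p q] u(2) u' v(2) v'(1)  unfolding uv by blast
          then have "fst y \<in> P \<inter> ?A" "snd y \<in> P \<inter> ?A" using v'(2,3) pq by auto
          then have "(fst y, snd y) \<in> inside N (P \<inter> ?A)" using y(2) PN by (intro insideI) blast+
          then show ?thesis using y(1) by auto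
        qed
        moreover have "p \<in> ?A" "q \<in> ?A" "a \<in> ?A" "b \<in> ?A" using 1 pq(1) ab(1) by simp_all
        moreover have "c \<notin> ?A \<or> d \<notin> ?A" using cross by auto
        ultimately show False using smaller[of ?A] by blast
      next
        case 2
        let ?A = "{..p} \<union> {q..}"
        have "\<exists>v\<in>inside N (P \<inter> ?A). cross u v"
          if u: "u \<in> inside N (P \<inter> ?A)" "u \<noteq> (p, q)" and v: "v \<in> inside N P" "cross u v" for u v
        proof -
          obtain u1 u2 v1 v2 where uv: "u = (u1, u2)" "v = (v1, v2)" by force
          have u': "u1 < u2" "u1 \<le> p \<or> q \<le> u1" "u2 \<le> p \<or> q \<le> u2"
            using u(1) by (simp_all add: inside_def pairs_def uv)
          have v': "v1 < v2" "v1 \<in> P" "v2 \<in> P" using v(1) by (simp_all add: inside_def pairs_def uv)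
          obtain y where y: "cross u y" "fst y < snd y" "{fst y, snd y} \<subseteq> {p, q} \<union> {v1, v2} \<inter> ?A"
            using cross_to_part_outside[of u1 u2 v1 v2 p q] u(2) u' v(2) v'(1) pq(1) unfolding uv by blast
          then have "fst y \<in> P \<inter> ?A" "snd y \<in> P \<inter> ?A" using v'(2,3) pq by auto
          then have "(fst y, snd y) \<in> inside N (P \<inter> ?A)" using y(2) PN by (intro insideI) blast+
          then show ?thesis using y(1) by auto
        qed
        moreover have "p \<in> ?A" "q \<in> ?A" "a \<in> ?A" "b \<in> ?A" using 2 pq(1) ab(1) by simp_all
        moreover have "c \<notin> ?A \<or> d \<notin> ?A" using cross by auto
        ultimately show False using smaller[of ?A] by blast
      qed
    qed
    then show "z \<in> E \<longleftrightarrow> \<not> (\<exists>y\<in>inside N P. cross z y)" using closed[OF z] by blast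
  qed
qed

lemma four_of_card:
  assumes "3 < card (P :: nat set)"
  obtains a b c d where "a \<in> P" "b \<in> P" "c \<in> P" "d \<in> P" "a < b" "b < c" "c < d"
proof -
  define xs where "xs = sorted_list_of_set P"
  have fin: "finite P" using assms card.infinite by force
  have len: "3 < length xs" using assms by (simp add: xs_def)
  have "sorted_wrt (<) xs" by (simp add: xs_def)
  then have "xs ! 0 < xs ! 1" "xs ! 1 < xs ! 2" "xs ! 2 < xs ! 3"
    using len by (auto intro: sorted_wrt_nth_less)
  moreover have "xs ! i \<in> P" if "i < 4" for i
    using nth_mem[of i xs] len that fin by (simp add: xs_def)
  ultimately show thesis using that[of "xs ! 0" "xs ! 1" "xs ! 2" "xs ! 3"] by simp
qed

text \<open>Four vertices of a region give a diagonal that is not an edge, hence is crossed by an edge \<open>(r, s)\<close>.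
An endpoint \<open>t\<close> of this edge lies outside the region, because otherwise \<open>(r, s)\<close> would be a diagonal of it. But
then \<open>(r, s)\<close> crosses the side of the region that separates \<open>t\<close> from it.\<close>

lemma (in symmetric_triangulation) region_has_three_vertices:
  assumes P: "P \<subseteq> {1..2 * N}" "3 \<le> card P"
    and reg: "\<And>u. u \<in> inside N P \<Longrightarrow> u \<in> E \<longleftrightarrow> \<not> (\<exists>y\<in>inside N P. cross u y)"
  shows "card P = 3"
proof (rule ccontr)
  assume "card P \<noteq> 3"
  then obtain a b c d where abcd: "a \<in> P" "b \<in> P" "c \<in> P" "d \<in> P" "a < b" "b < c" "c < d"
    using P(2) four_of_card[of P] by (metis le_neq_implies_less)
  have fin: "finite P" using P(1) by (rule finite_subset) simp
  have ac: "(a, c) \<in> inside N P" and bd: "(b, d) \<in> inside N P" using abcd by (auto intro: insideI[OF _ _ _ P(1)])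
  have "cross (a, c) (b, d)" using abcd by (simp add: cross_def)
  then have "(a, c) \<notin> E" using reg[OF ac] bd by blast
  then obtain r s where rs: "(r, s) \<in> E" "cross (a, c) (r, s)"
    using maximal[of "(a, c)"] ac by (auto simp: inside_def)
  have "r \<notin> P \<or> s \<notin> P"
  proof (rule ccontr)
    assume "\<not> (r \<notin> P \<or> s \<notin> P)"
    then have "(r, s) \<in> inside N P" using rs(1) E_range by (auto intro: insideI[OF _ _ _ P(1)])
    then show False using reg[of "(r, s)"] rs ac cross_sym by blast
  qed
  then obtain t t' where t: "t \<notin> P" "(t, t') = (r, s) \<or> (t', t) = (r, s)" by blast
  have alt: "a < t \<and> t < c \<and> (t' < a \<or> c < t') \<or> a < t' \<and> t' < c \<and> (t < a \<or> c < t)"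
    using rs(2) t(2) by (auto simp: cross_def)
  have side: "(x, y) \<in> E" if "x \<in> P" "y \<in> P" "x < y"
    "(\<forall>z\<in>P. z \<le> x \<or> y \<le> z) \<or> (\<forall>z\<in>P. x \<le> z \<and> z \<le> y)" for x y
  proof -
    have "\<not> cross (x, y) v" if "v \<in> inside N P" for v
      using that \<open>_ \<or> (\<forall>z\<in>P. x \<le> z \<and> z \<le> y)\<close> by (fastforce simp: cross_def inside_def)
    then show ?thesis using reg[of "(x, y)"] insideI[OF that(1-3) P(1)] by blast
  qed
  have no: False if "(x, y) \<in> E" "x < t \<and> t < y \<and> (t' < x \<or> y < t') \<or> x < t' \<and> t' < y \<and> (t < x \<or> y < t)" for x y
  proof -
    have "cross (x, y) (r, s)" using that(2) t(2) E_range[OF rs(1)] by (auto simp: cross_def)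
    then show False using noncrossing[OF that(1) rs(1)] by blast
  qed
  define lo hi where "lo = {z \<in> P. z < t}" and "hi = {z \<in> P. t < z}"
  have fin': "finite lo" "finite hi" using fin by (auto simp: lo_def hi_def)
  show False
  proof (cases "lo = {} \<or> hi = {}")
    case True
    have ne: "P \<noteq> {}" using abcd by blast
    have M: "Min P \<in> P" "Max P \<in> P" using fin ne by simp_all
    have b: "Min P \<le> a" "c < Max P" using Min_le[OF fin abcd(1)] Max_ge[OF fin abcd(4)] abcd by simp_all
    have e: "(Min P, Max P) \<in> E" using fin M b abcd(5,6) by (intro side) simp_all
    have "t < Min P \<or> Max P < t" using True M t(1) by (auto simp: lo_def hi_def) (metis linorder_neqE_nat)+
    then show False using no[OF e] alt b by linarith
  next
    case False
    have M: "Max lo \<in> lo" "Min hi \<in> hi" using fin' False by simp_all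
    have mx: "z \<le> Max lo \<or> Min hi \<le> z" if "z \<in> P" for z
    proof (cases "z < t")
      case True then show ?thesis using that fin' by (auto simp: lo_def intro: Max_ge)
    next
      case False then show ?thesis using that fin' t(1) by (cases "z = t") (auto simp: hi_def intro: Min_le)
    qed
    have lt: "Max lo < t" "t < Min hi" "Max lo \<in> P" "Min hi \<in> P" using M by (auto simp: lo_def hi_def)
    have e: "(Max lo, Min hi) \<in> E" using lt mx by (intro side) auto
    show False using no[OF e] lt alt mx[OF abcd(1)] mx[OF abcd(3)] by linarith
  qed
qed

section \<open>Symmetric triangulations of the polygon\<close>

lemma pos_vtx_image: "P \<subseteq> {1..2 * N} \<Longrightarrow> pos n ` vtx n ` P = P"
  by (force simp: pos_vtx image_image)

lemma card_vtx_image: "P \<subseteq> {1..2 * N} \<Longrightarrow> card (vtx n ` P) = card P"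
  by (intro card_image inj_onI) (metis atLeastAtMost_iff pos_vtx subsetD)

lemma card_pos_image: "F \<subseteq> vertices n \<Longrightarrow> card (pos n ` F) = card F"
  by (intro card_image inj_onI) (use pos_eq_iff in blast)

lemma four_of_cross:
  assumes "u \<in> inside N P" "y \<in> inside N P" "cross u y" "finite P"
  shows "3 < card P"
proof -
  have "card {fst u, snd u, fst y, snd y} = 4"
    using assms(1-3) by (auto simp: cross_def inside_def pairs_def)
  moreover have "{fst u, snd u, fst y, snd y} \<subseteq> P" using assms(1,2) by (simp add: inside_def)
  ultimately show ?thesis using card_mono[OF assms(4), of "{fst u, snd u, fst y, snd y}"] by simp
qed

lemma bar_edge:
  assumes "S \<in> triangulations_B n" "C \<in> S \<union> sides n"
  shows "bar ` C \<in> S \<union> sides n"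
proof (cases "C \<in> S")
  case True
  then have "bar ` C \<in> (\<lambda>C. bar ` C) ` S" by (rule imageI)
  then show ?thesis using assms(1) by (simp add: triangulations_B_def)
next
  case False
  then obtain x where "x \<in> boundary (n + 1)" "C = seg n x" using assms(2) by (auto simp: sides_eq)
  then have "bar ` C \<in> sides n"
    using bar_seg[of x n] opp_boundary[of x "n + 1"] boundary_pairs by (auto simp: sides_eq)
  then show ?thesis by simp
qed

text \<open>Maximality is where the condition on regions enters: a pair that could be added would be a diagonal
of a region with at least four vertices.\<close>

lemma edges_triangulation:
  assumes n: "1 \<le> n" and S: "S \<in> triangulations_B n"
  shows "symmetric_triangulation (n + 1) (edges n S)"
proof
  have chords: "S \<subseteq> chords n" and nc: "\<And>C D. C \<in> S \<Longrightarrow> D \<in> S \<Longrightarrow> \<not> crosses n C D"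
    and tri: "\<And>F. region n S F \<Longrightarrow> card F = 3"
    using S by (simp_all add: triangulations_B_def triangulation_def)
  show "2 \<le> n + 1" using n by simp
  show E: "edges n S \<subseteq> pairs (n + 1)" by (auto simp: edges_def)
  show B: "boundary (n + 1) \<subseteq> edges n S"
    using boundary_pairs seg_in_sides unfolding edges_def by blast
  show "\<not> cross x y" if xy: "x \<in> edges n S" "y \<in> edges n S" for x y
  proof -
    have p: "x \<in> pairs (n + 1)" "y \<in> pairs (n + 1)" using xy E by blast+
    show ?thesis
    proof (cases "x \<in> boundary (n + 1) \<or> y \<in> boundary (n + 1)")
      case True
      then show ?thesis using not_cross_boundary p cross_sym by blast
    next
      case False
      then have "seg n x \<in> S" "seg n y \<in> S"
        using xy seg_in_sides[OF p(1)] seg_in_sides[OF p(2)] by (simp_all add: edges_def)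
      then show ?thesis using nc crosses_seg p by blast
    qed
  qed
  show "opp (n + 1) x \<in> edges n S" if "x \<in> edges n S" for x
  proof -
    have x: "x \<in> pairs (n + 1)" "seg n x \<in> S \<union> sides n" using that by (simp_all add: edges_def)
    then have "seg n (opp (n + 1) x) \<in> S \<union> sides n"
      using bar_edge[OF S x(2)] bar_seg[OF x(1)] by simp
    then show ?thesis using opp_pairs[OF x(1)] by (simp add: edges_def)
  qed
  fix x assume x: "x \<in> pairs (n + 1)" "\<And>y. y \<in> edges n S \<Longrightarrow> \<not> cross x y"
  show "x \<in> edges n S"
  proof (rule ccontr)
    assume "x \<notin> edges n S"
    then obtain P where P: "P \<subseteq> {1..2 * (n + 1)}" 
      and cr: "\<exists>u\<in>inside (n + 1) P. \<exists>y\<in>inside (n + 1) P. cross u y"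
      and reg: "\<And>u. u \<in> inside (n + 1) P \<Longrightarrow>
        u \<in> edges n S \<longleftrightarrow> \<not> (\<exists>y\<in>inside (n + 1) P. cross u y)"
      using region_around[OF E B x(1) _ x(2)] by blast
    have card: "3 < card P" using cr four_of_cross finite_subset[OF P] by blast
    have "vtx n ` P \<subseteq> vertices n" using P vtx_vertices by auto
    moreover have "pos n ` vtx n ` P = P" by (rule pos_vtx_image[OF P])
    ultimately have "region n S (vtx n ` P)"
      using region_iff[of "vtx n ` P" n S] card_vtx_image[OF P, of n] card reg by simp
    then show False using tri card_vtx_image[OF P, of n] card by fastforce
  qed
qed

lemma triangulation_of_edges:
  assumes E: "symmetric_triangulation (n + 1) E"
  shows "seg n ` (E - boundary (n + 1)) \<in> triangulations_B n"
proof -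
  interpret symmetric_triangulation "n + 1" E by (rule E)
  let ?S = "seg n ` (E - boundary (n + 1))"
  have bar_sub: "bar ` C \<in> ?S" if "C \<in> ?S" for C
  proof -
    obtain x where x: "x \<in> E" "x \<notin> boundary (n + 1)" "C = seg n x" using \<open>C \<in> ?S\<close> by blast
    then have xp: "x \<in> pairs (n + 1)" using E_pairs by blast
    have "opp (n + 1) x \<notin> boundary (n + 1)" using opp_boundary opp_opp[OF xp] x(2) by metis
    then have "seg n (opp (n + 1) x) \<in> ?S" using opp_E[OF x(1)] by simp
    then show ?thesis using x(3) bar_seg[OF xp] by simp
  qed
  have "(\<lambda>C. bar ` C) ` ?S = ?S"
  proof
    show "(\<lambda>C. bar ` C) ` ?S \<subseteq> ?S" by (rule image_subsetI) (rule bar_sub)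
    show "?S \<subseteq> (\<lambda>C. bar ` C) ` ?S"
    proof
      fix C assume "C \<in> ?S"
      then have "bar ` bar ` C \<in> (\<lambda>C. bar ` C) ` ?S" by (intro imageI bar_sub)
      then show "C \<in> (\<lambda>C. bar ` C) ` ?S" by (simp only: bar_image_bar_image)
    qed
  qed
  moreover have "?S \<subseteq> chords n" using E_pairs unfolding chords_eq by (intro image_mono) blast
  moreover have "\<not> crosses n C D" if CD: "C \<in> ?S" "D \<in> ?S" for C D
  proof -
    obtain x y where xy: "C = seg n x" "D = seg n y" "x \<in> E" "y \<in> E" using CD by blast
    then have "x \<in> pairs (n + 1)" "y \<in> pairs (n + 1)" using E_pairs by blast+
    then show ?thesis using crosses_seg[of x n y] noncrossing[OF xy(3,4)] xy(1,2) by simp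
  qed
  moreover have "card F = 3" if R: "region n ?S F" for F
  proof -
    have F: "F \<subseteq> vertices n" using R by (simp add: region_def)
    have "pos n v \<in> {1..2 * (n + 1)}" if "v \<in> F" for v using F that pos_range[of v n] by auto
    then have P: "pos n ` F \<subseteq> {1..2 * (n + 1)}" by blast
    have "edges n ?S = E" by (rule edges_of_chords[OF boundary_E E_pairs])
    then have reg: "3 \<le> card F" "\<forall>x\<in>inside (n + 1) (pos n ` F).
       x \<in> E \<longleftrightarrow> \<not> (\<exists>y\<in>inside (n + 1) (pos n ` F). cross x y)"
      using R region_iff[OF F, of ?S] by simp_all
    have "card (pos n ` F) = 3"
      using reg(1) card_pos_image[OF F] by (intro region_has_three_vertices[OF P] bspec[OF reg(2)]) simp_all
    then show ?thesis using card_pos_image[OF F] by simp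
  qed
  ultimately show ?thesis
    unfolding triangulations_B_def triangulation_def mem_Collect_eq
    by (intro conjI ballI allI impI)
qed

section \<open>Quadrilaterals and colours\<close>

text \<open>Crossing segments have four distinct endpoints, so all segments within a triangle are sides.\<close>

lemma region_triangle:
  assumes F: "F \<subseteq> vertices n" "card F = 3"
  shows "region n S F \<longleftrightarrow> (\<forall>a\<in>F. \<forall>b\<in>F. a \<noteq> b \<longrightarrow> {a, b} \<in> S \<union> sides n)"
proof -
  have "\<not> crosses n {a, b} {c, d}" if abcd: "a \<in> F" "b \<in> F" "c \<in> F" "d \<in> F" for a b c d
  proof
    assume "crosses n {a, b} {c, d}"
    then obtain a' b' c' d' where
      s: "{a, b} = {a', b'} \<and> {c, d} = {c', d'} \<or> {a, b} = {c', d'} \<and> {c, d} = {a', b'}"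
      and o: "pos n a' < pos n c'" "pos n c' < pos n b'" "pos n b' < pos n d'"
      unfolding crosses_def by blast
    have "card {a', b', c', d'} = 4" using o by (auto simp: card_insert_if)
    moreover have "{a', b', c', d'} = {a, b} \<union> {c, d}" using s by (elim disjE) auto
    then have "{a', b', c', d'} \<subseteq> F" using abcd by simp
    moreover have "finite F" using F(2) card.infinite by fastforce
    ultimately show False using card_mono[of F "{a', b', c', d'}"] F(2) by simp
  qed
  then show ?thesis using F unfolding region_def by auto
qed

lemma quad_bar:
  assumes S: "S \<in> triangulations_B n"
  shows "quad n S (bar ` C) = bar ` quad n S C"
proof -
  have sub: "bar ` quad n S C \<subseteq> quad n S (bar ` C)" for C
  proof
    fix w assume "w \<in> bar ` quad n S C"
    then obtain v F where v: "w = bar v" "v \<in> F" "region n S F" "C \<subseteq> F" unfolding quad_def by blast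
    have F: "F \<subseteq> vertices n" "card F = 3"
      using v(3) S by (simp_all add: region_def triangulations_B_def triangulation_def)
    have "inj bar" by (rule inj_on_inverseI[of _ bar]) (rule bar_bar)
    then have "card (bar ` F) = 3" using F(2) card_image[of bar F] inj_on_subset by auto
    moreover have "bar ` F \<subseteq> vertices n" using F(1) bar_vertices by blast
    moreover have "{bar a, bar b} \<in> S \<union> sides n" if "a \<in> F" "b \<in> F" "a \<noteq> b" for a b
      using bar_edge[OF S, of "{a, b}"] v(3) that region_triangle[OF F] by simp
    ultimately have "region n S (bar ` F)" using region_triangle[of "bar ` F" n S] by auto
    then show "w \<in> quad n S (bar ` C)" using v unfolding quad_def by blast
  qed
  have "quad n S (bar ` C) = bar ` bar ` quad n S (bar ` C)" by (simp only: bar_image_bar_image)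
  also have "\<dots> \<subseteq> bar ` quad n S (bar ` bar ` C)" using sub by blast
  also have "\<dots> = bar ` quad n S C" by (simp only: bar_image_bar_image)
  finally show ?thesis using sub by blast
qed

lemma other_diagonal_bar:
  assumes S: "S \<in> triangulations_B n"
  shows "other_diagonal n S (bar ` C) = bar ` other_diagonal n S C"
proof -
  have "inj bar" by (rule inj_on_inverseI[of _ bar]) (rule bar_bar)
  then show ?thesis unfolding other_diagonal_def quad_bar[OF S] by (simp add: image_set_diff)
qed

context symmetric_triangulation
begin

text \<open>In each of the remaining sectors, an edge from \<open>z\<close> to \<open>b\<close> or \<open>d\<close> would cross a side of the
quadrilateral.\<close>

lemma common_neighbour_bd:
  assumes "a < b" "b < c" "c < d" "(a, b) \<in> E" "(b, c) \<in> E" "(c, d) \<in> E" "(a, d) \<in> E"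
    and "(z, b) \<in> E \<or> (b, z) \<in> E" "(z, d) \<in> E \<or> (d, z) \<in> E"
  shows "z = a \<or> z = c"
proof (rule ccontr)
  assume "\<not> (z = a \<or> z = c)"
  moreover have "z \<noteq> b" "z \<noteq> d" using assms(8,9) E_range by blast+
  ultimately consider "z < a" | "a < z" "z < b" | "b < z" "z < c" | "c < z" "z < d" | "d < z" by linarith
  then show False
  proof cases
    case 1
    then have "(z, b) \<in> E" using assms E_range[of b z] by auto
    then show False using no_cross[of z b a d] 1 assms by simp
  next
    case 2
    then have "(z, d) \<in> E" using assms E_range[of d z] by auto
    then show False using no_cross[of a b z d] 2 assms by simp
  next
    case 3
    then have "(z, d) \<in> E" using assms E_range[of d z] by auto
    then show False using no_cross[of b c z d] 3 assms by simp
  next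
    case 4
    then have "(b, z) \<in> E" using assms E_range[of z b] by auto
    then show False using no_cross[of b z c d] 4 assms by simp
  next
    case 5
    then have "(b, z) \<in> E" using assms E_range[of z b] by auto
    then show False using no_cross[of a d b z] 5 assms by simp
  qed
qed

lemma common_neighbour_ac:
  assumes "a < b" "b < c" "c < d" "(a, b) \<in> E" "(b, c) \<in> E" "(c, d) \<in> E" "(a, d) \<in> E"
    and "(z, a) \<in> E \<or> (a, z) \<in> E" "(z, c) \<in> E \<or> (c, z) \<in> E"
  shows "z = b \<or> z = d"
proof (rule ccontr)
  assume "\<not> (z = b \<or> z = d)"
  moreover have "z \<noteq> a" "z \<noteq> c" using assms(8,9) E_range by blast+
  ultimately consider "z < a" | "a < z" "z < b" | "b < z" "z < c" | "c < z" "z < d" | "d < z" by linarith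
  then show False
  proof cases
    case 1
    then have "(z, c) \<in> E" using assms E_range[of c z] by auto
    then show False using no_cross[of z c a d] 1 assms by simp
  next
    case 2
    then have "(z, c) \<in> E" using assms E_range[of c z] by auto
    then show False using no_cross[of a b z c] 2 assms by simp
  next
    case 3
    then have "(a, z) \<in> E" using assms E_range[of z a] by auto
    then show False using no_cross[of a z b c] 3 assms by simp
  next
    case 4
    then have "(a, z) \<in> E" using assms E_range[of z a] by auto
    then show False using no_cross[of a z c d] 4 assms by simp
  next
    case 5
    then have "(c, z) \<in> E" using assms E_range[of z c] by auto
    then show False using no_cross[of a d c z] 5 assms by simp
  qed
qed

end

lemma edge_between_vertices:
  assumes "1 \<le> p" "p \<le> 2 * (n + 1)" "1 \<le> q" "q \<le> 2 * (n + 1)" "p \<noteq> q"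
  shows "{vtx n p, vtx n q} \<in> S \<union> sides n \<longleftrightarrow> (p, q) \<in> edges n S \<or> (q, p) \<in> edges n S"
  using assms by (cases p q rule: linorder_cases) (auto simp: edges_def pairs_def seg_def insert_commute)

text \<open>A quadrilateral whose sides are edges; either diagonal may be present.\<close>

definition tetragon :: "(nat \<times> nat) set \<Rightarrow> nat \<Rightarrow> nat \<Rightarrow> nat \<Rightarrow> nat \<Rightarrow> bool" where
  "tetragon E a b c d \<longleftrightarrow> a < b \<and> b < c \<and> c < d \<and>
     (a, b) \<in> E \<and> (b, c) \<in> E \<and> (c, d) \<in> E \<and> (a, d) \<in> E"

lemma triangle_in_quad:
  assumes E: "(p, q) \<in> edges n S" "(q, r) \<in> edges n S" "(p, r) \<in> edges n S" and C: "C \<subseteq> vtx n ` {p, q, r}"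
  shows "vtx n ` {p, q, r} \<subseteq> quad n S C"
proof -
  have r: "1 \<le> p" "p < q" "q < r" "r \<le> 2 * (n + 1)" using E by (auto simp: edges_def pairs_def)
  then have P: "{p, q, r} \<subseteq> {1..2 * (n + 1)}" by auto
  have "vtx n ` {p, q, r} \<subseteq> vertices n" using P vtx_vertices by fastforce
  moreover have "card (vtx n ` {p, q, r}) = 3" using card_vtx_image[OF P, of n] r by simp
  moreover have "{vtx n u, vtx n v} \<in> S \<union> sides n" if "u \<in> {p, q, r}" "v \<in> {p, q, r}" "u \<noteq> v" for u v
    using that E edge_between_vertices[of u n v S] r by auto
  ultimately have "region n S (vtx n ` {p, q, r})"
    using region_triangle[of "vtx n ` {p, q, r}" n S] by blast
  then show ?thesis using C unfolding quad_def by blast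
qed

lemma quad_cases:
  assumes S: "S \<in> triangulations_B n" and w: "w \<in> quad n S (seg n (p, q))" "w \<notin> seg n (p, q)"
    and pq: "(p, q) \<in> pairs (n + 1)"
  obtains z where "w = vtx n z" "(z, p) \<in> edges n S \<or> (p, z) \<in> edges n S" "(z, q) \<in> edges n S \<or> (q, z) \<in> edges n S"
proof -
  obtain F where F: "w \<in> F" "region n S F" "seg n (p, q) \<subseteq> F" using w(1) unfolding quad_def by blast
  have V: "F \<subseteq> vertices n" "card F = 3"
    using F(2) S by (simp_all add: region_def triangulations_B_def triangulation_def)
  have wv: "w \<in> vertices n" using F(1) V(1) by blast
  define z where "z = pos n w"
  have z: "w = vtx n z" "1 \<le> z" "z \<le> 2 * (n + 1)"
    using vtx_pos[OF wv] pos_range[OF wv] by (simp_all add: z_def)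
  have r: "1 \<le> p" "p < q" "q \<le> 2 * (n + 1)" using pq by (simp_all add: pairs_def)
  have ne: "z \<noteq> p" "z \<noteq> q" using w(2) z(1) by (auto simp: seg_def)
  have "{vtx n z, vtx n p} \<in> S \<union> sides n" "{vtx n z, vtx n q} \<in> S \<union> sides n"
    using F region_triangle[OF V] w(2) unfolding z(1)[symmetric] seg_def by auto
  then show thesis
    using that[OF z(1)] edge_between_vertices[of z n p S] edge_between_vertices[of z n q S] z r ne by simp
qed

lemma quad_bd:
  assumes n: "1 \<le> n" and S: "S \<in> triangulations_B n"
    and T: "tetragon (edges n S) a b c d" and bd: "(b, d) \<in> edges n S"
  shows "quad n S (seg n (b, d)) = vtx n ` {a, b, c, d}"
proof -
  interpret symmetric_triangulation "n + 1" "edges n S" by (rule edges_triangulation[OF n S])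
  note T' = T[unfolded tetragon_def]
  have "w \<in> vtx n ` {a, b, c, d}" if w: "w \<in> quad n S (seg n (b, d))" for w
  proof (cases "w \<in> seg n (b, d)")
    case True then show ?thesis by (auto simp: seg_def)
  next
    case False
    obtain z where z: "w = vtx n z" "(z, b) \<in> edges n S \<or> (b, z) \<in> edges n S" "(z, d) \<in> edges n S \<or> (d, z) \<in> edges n S"
      using quad_cases[OF S w False] bd E_pairs by blast
    then have "z = a \<or> z = c" using T' by (intro common_neighbour_bd[of a b c d z]) simp_all
    then show ?thesis using z(1) by auto
  qed
  moreover have "vtx n ` {a, b, d} \<subseteq> quad n S (seg n (b, d))"
    using T' bd by (intro triangle_in_quad) (auto simp: seg_def)
  moreover have "vtx n ` {b, c, d} \<subseteq> quad n S (seg n (b, d))"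
    using T' bd by (intro triangle_in_quad) (auto simp: seg_def)
  ultimately show ?thesis by blast
qed

lemma quad_ac:
  assumes n: "1 \<le> n" and S: "S \<in> triangulations_B n"
    and T: "tetragon (edges n S) a b c d" and ac: "(a, c) \<in> edges n S"
  shows "quad n S (seg n (a, c)) = vtx n ` {a, b, c, d}"
proof -
  interpret symmetric_triangulation "n + 1" "edges n S" by (rule edges_triangulation[OF n S])
  note T' = T[unfolded tetragon_def]
  have "w \<in> vtx n ` {a, b, c, d}" if w: "w \<in> quad n S (seg n (a, c))" for w
  proof (cases "w \<in> seg n (a, c)")
    case True then show ?thesis by (auto simp: seg_def)
  next
    case False
    obtain z where z: "w = vtx n z" "(z, a) \<in> edges n S \<or> (a, z) \<in> edges n S" "(z, c) \<in> edges n S \<or> (c, z) \<in> edges n S"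
      using quad_cases[OF S w False] ac E_pairs by blast
    then have "z = b \<or> z = d" using T' by (intro common_neighbour_ac[of a b c d z]) simp_all
    then show ?thesis using z(1) by auto
  qed
  moreover have "vtx n ` {a, b, c} \<subseteq> quad n S (seg n (a, c))"
    using T' ac by (intro triangle_in_quad) (auto simp: seg_def)
  moreover have "vtx n ` {a, c, d} \<subseteq> quad n S (seg n (a, c))"
    using T' ac by (intro triangle_in_quad) (auto simp: seg_def)
  ultimately show ?thesis by blast
qed

lemma red_bd:
  assumes "quad n S (seg n (b, d)) = vtx n ` {a, b, c, d}" "1 \<le> a" "a < b" "b < c" "c < d" "d \<le> 2 * (n + 1)"
  shows "red n S (seg n (b, d)) \<longleftrightarrow> c \<le> n + 1 \<and> n + 1 < d"
  unfolding red_def assms(1) using assms(2-)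
  by (cases "d \<le> n + 1"; cases "c \<le> n + 1"; cases "b \<le> n + 1"; cases "a \<le> n + 1")
    (auto simp: seg_def pure_def same_type_def vtx_def)

lemma red_ac:
  assumes "quad n S (seg n (a, c)) = vtx n ` {a, b, c, d}" "1 \<le> a" "a < b" "b < c" "c < d" "d \<le> 2 * (n + 1)"
  shows "red n S (seg n (a, c)) \<longleftrightarrow> \<not> (c \<le> n + 1 \<and> n + 1 < d)"
  unfolding red_def assms(1) using assms(2-)
  by (cases "d \<le> n + 1"; cases "c \<le> n + 1"; cases "b \<le> n + 1"; cases "a \<le> n + 1")
    (auto simp: seg_def pure_def same_type_def vtx_def)

lemma seg_image_minus:
  assumes "1 \<le> a" "a < b" "b < c" "c < d"
  shows "vtx n ` {a, b, c, d} - seg n (b, d) = seg n (a, c)"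
  using assms by (auto simp: seg_def vtx_eq_iff)

section \<open>Flips\<close>

text \<open>A chord \<open>(p, q)\<close> is the diagonal \<open>(b, d)\<close> of its quadrilateral if the apex of the outer triangle lies
below \<open>p\<close>, and the diagonal \<open>(a, c)\<close> if it lies above \<open>q\<close>.\<close>

lemma chord_quad:
  assumes n: "1 \<le> n" and S: "S \<in> triangulations_B n" and C: "C \<in> S"
  obtains a b c d where "tetragon (edges n S) a b c d" "C = seg n (b, d)" "(b, d) \<in> edges n S"
    | a b c d where "tetragon (edges n S) a b c d" "C = seg n (a, c)" "(a, c) \<in> edges n S"
proof -
  interpret symmetric_triangulation "n + 1" "edges n S" by (rule edges_triangulation[OF n S])
  have "C \<in> chords n" using S C by (auto simp: triangulations_B_def triangulation_def)
  then obtain p q where pq: "C = seg n (p, q)" "(p, q) \<in> pairs (n + 1)" "(p, q) \<notin> boundary (n + 1)"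
    by (auto simp: chords_eq)
  have e: "(p, q) \<in> edges n S" using pq C by (simp add: edges_def)
  have "p + 1 < q" "(p, q) \<noteq> (1, 2 * (n + 1))" using pq(2,3) by (auto simp: pairs_def boundary_def)
  obtain m where m: "p < m" "m < q" "(p, m) \<in> edges n S" "(m, q) \<in> edges n S"
    using inner_triangle[OF e \<open>p + 1 < q\<close>] by blast
  from e \<open>(p, q) \<noteq> (1, 2 * (n + 1))\<close> show thesis
  proof (rule outer_triangle)
    fix k assume "k < p" "(k, p) \<in> edges n S" "(k, q) \<in> edges n S"
    then show thesis using that(1)[of k p m q] m e pq(1) by (simp add: tetragon_def)
  next
    fix k assume "q < k" "(p, k) \<in> edges n S" "(q, k) \<in> edges n S"
    then show thesis using that(2)[of p m q k] m e pq(1) by (simp add: tetragon_def)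
  qed
qed

lemma tetragon_range:
  assumes "tetragon (edges n S) a b c d"
  shows "1 \<le> a" "a < b" "b < c" "c < d" "d \<le> 2 * (n + 1)"
  using assms by (auto simp: tetragon_def edges_def pairs_def)

lemma up_quad_tetragon: "up_quad N E a b c d \<longleftrightarrow> tetragon E a b c d \<and> N < c \<and> (b, d) \<in> E"
  by (auto simp: up_quad_def tetragon_def)

text \<open>A green \<open>(b, d)\<close> has \<open>c\<close> barred or all four vertices unbarred; the latter case is turned into the
former by the half-turn. A green \<open>(a, c)\<close> has \<open>d\<close> as its only barred vertex, and the half-turn makes \<open>d\<close>
the first vertex of the quadrilateral and \<open>(a, c)\<close> its diagonal \<open>(b, d)\<close>.\<close>

lemma up_quad_of_green:
  assumes n: "1 \<le> n" and S: "S \<in> triangulations_B n" and C: "C \<in> S" and green: "green n S C"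
  obtains a b c d where "up_quad (n + 1) (edges n S) a b c d"
    "C = seg n (b, d) \<or> bar ` C = seg n (b, d)"
proof -
  interpret symmetric_triangulation "n + 1" "edges n S" by (rule edges_triangulation[OF n S])
  let ?s = "\<lambda>x. x + (n + 1)"
  show thesis
  proof (rule chord_quad[OF n S C])
    fix a b c d assume T: "tetragon (edges n S) a b c d" and bd: "C = seg n (b, d)" "(b, d) \<in> edges n S"
    note r = tetragon_range[OF T]
    have "\<not> (c \<le> n + 1 \<and> n + 1 < d)"
      using green red_bd[OF quad_bd[OF n S T bd(2)] r] bd(1) by simp
    then consider "n + 1 < c" | "d \<le> n + 1" by linarith
    then show thesis
    proof cases
      case 1
      then show thesis using that[of a b c d] T bd by (simp add: up_quad_tetragon)
    next
      case 2
      have "(?s a, ?s b) \<in> edges n S" "(?s b, ?s c) \<in> edges n S" "(?s c, ?s d) \<in> edges n S"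
        "(?s a, ?s d) \<in> edges n S" "(?s b, ?s d) \<in> edges n S"
        using T bd(2) 2 r unfolding tetragon_def by (intro opp_low; simp)+
      then have "up_quad (n + 1) (edges n S) (?s a) (?s b) (?s c) (?s d)"
        using r by (simp add: up_quad_def)
      moreover have "(b, d) \<in> pairs (n + 1)" using bd(2) E_pairs by blast
      then have "bar ` C = seg n (?s b, ?s d)"
        using bar_seg[of "(b, d)" n] bd(1) 2 by (simp add: opp_def)
      ultimately show thesis using that by blast
    qed
  next
    fix a b c d assume T: "tetragon (edges n S) a b c d" and ac: "C = seg n (a, c)" "(a, c) \<in> edges n S"
    note r = tetragon_range[OF T]
    have cd: "c \<le> n + 1" "n + 1 < d"
      using green red_ac[OF quad_ac[OF n S T ac(2)] r] ac(1) by simp_all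
    let ?d = "d - (n + 1)"
    have "(?s a, ?s b) \<in> edges n S" "(?s b, ?s c) \<in> edges n S" "(?s a, ?s c) \<in> edges n S"
      using T ac(2) cd r unfolding tetragon_def by (intro opp_low; simp)+
    moreover have "(?d, ?s a) \<in> edges n S" "(?d, ?s c) \<in> edges n S"
      using T cd r unfolding tetragon_def by (intro opp_mixed; simp)+
    ultimately have "up_quad (n + 1) (edges n S) ?d (?s a) (?s b) (?s c)"
      using r cd by (simp add: up_quad_def)
    moreover have "(a, c) \<in> pairs (n + 1)" using ac(2) E_pairs by blast
    then have "bar ` C = seg n (?s a, ?s c)"
      using bar_seg[of "(a, c)" n] ac(1) cd by (simp add: opp_def)
    ultimately show thesis using that by blast
  qed
qed

lemma flip_bar: "flip n S (bar ` C) = flip n S C"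
  unfolding flip_def bar_image_bar_image by (simp add: insert_commute)

lemma other_diagonal_bd:
  assumes n: "1 \<le> n" and S: "S \<in> triangulations_B n"
    and T: "tetragon (edges n S) a b c d" and bd: "(b, d) \<in> edges n S"
  shows "other_diagonal n S (seg n (b, d)) = seg n (a, c)"
  unfolding other_diagonal_def quad_bd[OF n S T bd]
  using seg_image_minus tetragon_range[OF T] by blast

lemma edges_flip:
  assumes n: "1 \<le> n" and S: "S \<in> triangulations_B n"
    and Q: "up_quad (n + 1) (edges n S) a b c d"
  shows "edges n (flip n S (seg n (b, d))) = raise (n + 1) (edges n S) a b c d"
proof -
  interpret symmetric_triangulation "n + 1" "edges n S" by (rule edges_triangulation[OF n S])
  have T: "tetragon (edges n S) a b c d" and bd: "(b, d) \<in> edges n S"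
    using Q by (simp_all add: up_quad_tetragon)
  note r = tetragon_range[OF T]
  have p: "(b, d) \<in> pairs (n + 1)" "(a, c) \<in> pairs (n + 1)" using r by (simp_all add: pairs_def)
  have od: "other_diagonal n S (seg n (b, d)) = seg n (a, c)"
    by (rule other_diagonal_bd[OF n S T bd])
  have od': "other_diagonal n S (bar ` seg n (b, d)) = seg n (opp (n + 1) (a, c))"
    unfolding other_diagonal_bar[OF S] od by (rule bar_seg[OF p(2)])
  have nb: "(b, d) \<notin> boundary (n + 1)" using r by (auto simp: boundary_def)
  then have nb': "opp (n + 1) (b, d) \<notin> boundary (n + 1)"
    using opp_boundary[of "opp (n + 1) (b, d)" "n + 1"] opp_opp[OF p(1)] by auto
  have F: "flip n S (seg n (b, d)) =
      S - {seg n (b, d), seg n (opp (n + 1) (b, d))} \<union> {seg n (a, c), seg n (opp (n + 1) (a, c))}"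
    unfolding flip_def od od' unfolding bar_seg[OF p(1)] ..
  have "x \<in> edges n (flip n S (seg n (b, d))) \<longleftrightarrow> x \<in> raise (n + 1) (edges n S) a b c d"
    if x: "x \<in> pairs (n + 1)" for x
  proof -
    have eq: "seg n x = seg n y \<longleftrightarrow> x = y" if "y \<in> pairs (n + 1)" for y using seg_eq_iff[OF x that] .
    note eqs = eq[OF p(1)] eq[OF p(2)] eq[OF opp_pairs[OF p(1)]] eq[OF opp_pairs[OF p(2)]]
    show ?thesis
      unfolding F edges_def raise_def using x seg_in_sides[OF x] nb nb' eqs by auto
  qed
  moreover have "raise (n + 1) (edges n S) a b c d \<subseteq> pairs (n + 1)"
    using symmetric_triangulation.E_pairs[OF raise_triangulation[OF Q]] .
  moreover have "edges n (flip n S (seg n (b, d))) \<subseteq> pairs (n + 1)" by (auto simp: edges_def)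
  ultimately show ?thesis by blast
qed

lemma flip_subset_chords:
  assumes n: "1 \<le> n" and S: "S \<in> triangulations_B n"
    and Q: "up_quad (n + 1) (edges n S) a b c d"
  shows "flip n S (seg n (b, d)) \<subseteq> chords n"
proof -
  have T: "tetragon (edges n S) a b c d" and bd: "(b, d) \<in> edges n S"
    using Q by (simp_all add: up_quad_tetragon)
  note r = tetragon_range[OF T]
  have ac: "(a, c) \<in> pairs (n + 1)" using r by (simp add: pairs_def)
  have nac: "(a, c) \<notin> boundary (n + 1)" using r by (auto simp: boundary_def)
  then have nac': "opp (n + 1) (a, c) \<notin> boundary (n + 1)"
    using opp_boundary[of "opp (n + 1) (a, c)" "n + 1"] opp_opp[OF ac] by auto
  have od: "other_diagonal n S (seg n (b, d)) = seg n (a, c)"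
    by (rule other_diagonal_bd[OF n S T bd])
  have od': "other_diagonal n S (bar ` seg n (b, d)) = seg n (opp (n + 1) (a, c))"
    unfolding other_diagonal_bar[OF S] od by (rule bar_seg[OF ac])
  have "seg n (a, c) \<in> chords n" "seg n (opp (n + 1) (a, c)) \<in> chords n"
    unfolding chords_eq using ac nac nac' opp_pairs[OF ac] by (intro imageI; simp)+
  moreover have "S \<subseteq> chords n" using S by (simp add: triangulations_B_def triangulation_def)
  ultimately show ?thesis unfolding flip_def od od' by blast
qed

lemma edges_inject:
  assumes "S \<in> triangulations_B n" "T \<in> triangulations_B n" "edges n S = edges n T"
  shows "S = T"
proof -
  have "S \<subseteq> chords n" "T \<subseteq> chords n"
    using assms(1,2) by (simp_all add: triangulations_B_def triangulation_def)
  then show ?thesis using chords_of_edges assms(3) by metis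
qed

lemma seg_in_triangulation:
  assumes "x \<in> edges n S" "x \<notin> boundary (n + 1)"
  shows "seg n x \<in> S"
proof -
  have "x \<in> pairs (n + 1)" using assms(1) by (simp add: edges_def)
  then show ?thesis using assms seg_in_sides[of x n] by (simp add: edges_def)
qed

lemma same_type_bar: "same_type (bar u) (bar v) \<longleftrightarrow> same_type u v"
  by (cases u; cases v) (simp_all add: same_type_def)

lemma label_bar: "label (bar v) = label v"
  by (cases v) simp_all

lemma red_bar:
  assumes "S \<in> triangulations_B n"
  shows "red n S (bar ` C) \<longleftrightarrow> red n S C"
  unfolding red_def quad_bar[OF assms] pure_def by (simp add: same_type_bar label_bar)

lemma green_of_up_quad:
  assumes n: "1 \<le> n" and S: "S \<in> triangulations_B n"
    and Q: "up_quad (n + 1) (edges n S) a b c d"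
  shows "seg n (b, d) \<in> S" "green n S (seg n (b, d))"
proof -
  have T: "tetragon (edges n S) a b c d" and bd: "(b, d) \<in> edges n S" and c: "n + 1 < c"
    using Q by (simp_all add: up_quad_tetragon)
  note r = tetragon_range[OF T]
  show "green n S (seg n (b, d))" using red_bd[OF quad_bd[OF n S T bd] r] c by simp
  show "seg n (b, d) \<in> S" using bd r by (intro seg_in_triangulation) (auto simp: boundary_def)
qed

text \<open>A side of the quadrilateral has exactly one endpoint in common with the diagonal \<open>(b, d)\<close>, whereas the
partner of this diagonal is disjoint from it or equal to it; so no side is removed.\<close>

lemma raise_keeps_tetragon:
  assumes Q: "up_quad N E a b c d" and E: "E \<subseteq> pairs N"
  shows "tetragon (raise N E a b c d) a b c d" "(a, c) \<in> raise N E a b c d"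
proof -
  have "1 \<le> a" "d \<le> 2 * N" using Q E by (auto simp: up_quad_def pairs_def)
  then show "tetragon (raise N E a b c d) a b c d" "(a, c) \<in> raise N E a b c d"
    using Q by (auto simp: up_quad_def raise_def tetragon_def opp_def split: if_splits)
qed

text \<open>After the flip the quadrilateral is the same, and the diagonal \<open>(a, c)\<close> is red since \<open>c\<close> is
barred.\<close>

lemma red_after_flip:
  assumes n: "1 \<le> n" and S: "S \<in> triangulations_B n" and C: "C \<in> S" and green: "green n S C"
    and T: "flip n S C \<in> triangulations_B n"
  shows "red n (flip n S C) (other_diagonal n S C)"
proof -
  obtain a b c d where Q: "up_quad (n + 1) (edges n S) a b c d"
    and C': "C = seg n (b, d) \<or> bar ` C = seg n (b, d)"
    using up_quad_of_green[OF n S C green] by blast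
  have T0: "tetragon (edges n S) a b c d" and bd: "(b, d) \<in> edges n S" and c: "n + 1 < c"
    using Q by (simp_all add: up_quad_tetragon)
  note r = tetragon_range[OF T0]
  have F: "flip n S C = flip n S (seg n (b, d))" using C' flip_bar[of n S C] by auto
  have eT: "edges n (flip n S C) = raise (n + 1) (edges n S) a b c d"
    unfolding F by (rule edges_flip[OF n S Q])
  have od: "other_diagonal n S (seg n (b, d)) = seg n (a, c)"
    by (rule other_diagonal_bd[OF n S T0 bd])
  have "edges n S \<subseteq> pairs (n + 1)" by (auto simp: edges_def)
  note K = raise_keeps_tetragon[OF Q this, folded eT]
  have red: "red n (flip n S C) (seg n (a, c))"
    using red_ac[OF quad_ac[OF n T K] r] c by simp
  show ?thesis
  proof (cases "C = seg n (b, d)")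
    case True
    then show ?thesis using red od by simp
  next
    case False
    then have "bar ` other_diagonal n S C = seg n (a, c)"
      using C' od other_diagonal_bar[OF S, of C] by simp
    then show ?thesis using red red_bar[OF T, of "other_diagonal n S C"] by simp
  qed
qed

section \<open>The lattice\<close>

text \<open>Upward flips lower left ends, hence the reversed comparison of \<open>T\<close> with \<open>S\<close>.\<close>

definition tamari_B :: "nat \<Rightarrow> vertex set set gorder" where
  "tamari_B n = \<lparr>carrier = triangulations_B n, eq = (=),
     le = (\<lambda>S T. \<forall>v. n + 1 < v \<and> v < 2 * (n + 1) \<longrightarrow> left_end (edges n T) v \<le> left_end (edges n S) v)\<rparr>"

lemma carrier_tamari_B: "carrier (tamari_B n) = triangulations_B n"
  by (simp add: tamari_B_def)

lemma le_tamari_B: "S \<sqsubseteq>\<^bsub>tamari_B n\<^esub> T \<longleftrightarrow>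
    (\<forall>v. n + 1 < v \<and> v < 2 * (n + 1) \<longrightarrow> left_end (edges n T) v \<le> left_end (edges n S) v)"
  by (simp add: tamari_B_def)

lemma partial_order_tamari_B:
  assumes n: "1 \<le> n"
  shows "partial_order (tamari_B n)"
proof
  fix S T assume "S \<sqsubseteq>\<^bsub>tamari_B n\<^esub> T" "T \<sqsubseteq>\<^bsub>tamari_B n\<^esub> S"
    and ST: "S \<in> carrier (tamari_B n)" "T \<in> carrier (tamari_B n)"
  then have eq: "left_end (edges n S) v = left_end (edges n T) v" if "n + 1 < v" "v < 2 * (n + 1)" for v
    using that by (intro antisym) (simp_all add: le_tamari_B)
  have "symmetric_triangulation (n + 1) (edges n S)" "symmetric_triangulation (n + 1) (edges n T)"
    using ST edges_triangulation[OF n] by (simp_all add: carrier_tamari_B)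
  then have "edges n S = edges n T"
    using triangulation_subset_of_left_ends[OF _ _ eq] triangulation_subset_of_left_ends[OF _ _ eq[symmetric]]
    by (intro equalityI)
  then show "S .=\<^bsub>tamari_B n\<^esub> T" using edges_inject[of S n T] ST by (simp add: tamari_B_def)
qed (auto simp: tamari_B_def intro: order_trans)

lemma infimum_tamari_B:
  assumes n: "1 \<le> n" and A: "A \<subseteq> triangulations_B n"
  obtains I where "I \<in> triangulations_B n" "\<And>S. S \<in> A \<Longrightarrow> I \<sqsubseteq>\<^bsub>tamari_B n\<^esub> S"
    "\<And>D. D \<in> triangulations_B n \<Longrightarrow> (\<And>S. S \<in> A \<Longrightarrow> D \<sqsubseteq>\<^bsub>tamari_B n\<^esub> S) \<Longrightarrow> D \<sqsubseteq>\<^bsub>tamari_B n\<^esub> I"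
proof -
  have two: "2 \<le> n + 1" using n by simp
  have tri: "symmetric_triangulation (n + 1) F" if "F \<in> edges n ` A" for F
    using that A edges_triangulation[OF n] by blast
  show thesis
  proof (rule infimum_of_left_ends[OF two tri])
    fix E assume E: "symmetric_triangulation (n + 1) E"
      and lower: "\<And>F v. F \<in> edges n ` A \<Longrightarrow> n + 1 < v \<Longrightarrow> v < 2 * (n + 1) \<Longrightarrow> left_end F v \<le> left_end E v"
      and greatest: "\<And>D v. symmetric_triangulation (n + 1) D \<Longrightarrow>
        (\<And>F v. F \<in> edges n ` A \<Longrightarrow> n + 1 < v \<Longrightarrow> v < 2 * (n + 1) \<Longrightarrow> left_end F v \<le> left_end D v) \<Longrightarrow>
        n + 1 < v \<Longrightarrow> v < 2 * (n + 1) \<Longrightarrow> left_end E v \<le> left_end D v"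
    interpret symmetric_triangulation "n + 1" E by (rule E)
    let ?I = "seg n ` (E - boundary (n + 1))"
    have eI: "edges n ?I = E" by (rule edges_of_chords[OF boundary_E E_pairs])
    show thesis
    proof (rule that)
      show "?I \<in> triangulations_B n" by (rule triangulation_of_edges[OF E])
      show "?I \<sqsubseteq>\<^bsub>tamari_B n\<^esub> S" if "S \<in> A" for S
        unfolding le_tamari_B eI using lower that by blast
      fix D assume D: "D \<in> triangulations_B n" and le: "\<And>S. S \<in> A \<Longrightarrow> D \<sqsubseteq>\<^bsub>tamari_B n\<^esub> S"
      have "left_end F v \<le> left_end (edges n D) v" if "F \<in> edges n ` A" "n + 1 < v" "v < 2 * (n + 1)" for F v
        using that le unfolding le_tamari_B by blast
      then show "D \<sqsubseteq>\<^bsub>tamari_B n\<^esub> ?I"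
        unfolding le_tamari_B eI using greatest[OF edges_triangulation[OF n D]] by blast
    qed
  qed
qed

lemma lattice_tamari_B:
  assumes n: "1 \<le> n"
  shows "lattice (tamari_B n)"
proof -
  have inf: "\<exists>i. greatest (tamari_B n) i (Lower (tamari_B n) A)" if A: "A \<subseteq> carrier (tamari_B n)" for A
  proof -
    have "A \<subseteq> triangulations_B n" using A by (simp add: carrier_tamari_B)
    with n show ?thesis
    proof (rule infimum_tamari_B)
      fix I assume I: "I \<in> triangulations_B n" "\<And>S. S \<in> A \<Longrightarrow> I \<sqsubseteq>\<^bsub>tamari_B n\<^esub> S"
        "\<And>D. D \<in> triangulations_B n \<Longrightarrow> (\<And>S. S \<in> A \<Longrightarrow> D \<sqsubseteq>\<^bsub>tamari_B n\<^esub> S) \<Longrightarrow> D \<sqsubseteq>\<^bsub>tamari_B n\<^esub> I"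
      have "I \<in> Lower (tamari_B n) A" using I(1,2) by (simp add: Lower_def carrier_tamari_B)
      moreover have "D \<sqsubseteq>\<^bsub>tamari_B n\<^esub> I" if D: "D \<in> Lower (tamari_B n) A" for D
        using D A by (intro I(3)) (auto simp: Lower_def carrier_tamari_B)
      moreover have "Lower (tamari_B n) A \<subseteq> carrier (tamari_B n)" by (simp add: Lower_def)
      ultimately have "greatest (tamari_B n) I (Lower (tamari_B n) A)" unfolding greatest_def by blast
      then show "\<exists>i. greatest (tamari_B n) i (Lower (tamari_B n) A)" by blast
    qed
  qed
  have "\<exists>g. greatest (tamari_B n) g (carrier (tamari_B n))"
    using inf[of "{}"] by (simp add: Lower_def)
  then have "complete_lattice (tamari_B n)"
    using partial_order.complete_lattice_criterion1[OF partial_order_tamari_B[OF n]] inf by blast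
  then show ?thesis by simp
qed


text \<open>If \<open>Z\<close> were strictly between \<open>S\<close> and a green flip \<open>T\<close> of \<open>S\<close>, some green flip \<open>X\<close> of \<open>S\<close> would satisfy
\<open>X \<le> Z < T\<close>; but comparable green flips of \<open>S\<close> coincide.\<close>

lemma covered_by_tamari_B:
  assumes n: "1 \<le> n" and S: "S \<in> triangulations_B n" and T: "T \<in> triangulations_B n"
  shows "covered_by (tamari_B n) S T \<longleftrightarrow> (\<exists>C\<in>S. green n S C \<and> T = flip n S C)"
proof -
  interpret L: partial_order "tamari_B n" by (rule partial_order_tamari_B[OF n])
  interpret symmetric_triangulation "n + 1" "edges n S" by (rule edges_triangulation[OF n S])
  let ?R = "raise (n + 1) (edges n S)"
  have less: "X \<sqsubset>\<^bsub>tamari_B n\<^esub> Y \<longleftrightarrow> X \<sqsubseteq>\<^bsub>tamari_B n\<^esub> Y \<and> X \<noteq> Y" for X Y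
    by (simp add: lless_def tamari_B_def)
  have up: "S \<sqsubset>\<^bsub>tamari_B n\<^esub> X"
    if "up_quad (n + 1) (edges n S) a b c d" "edges n X = ?R a b c d" for X a b c d
    using raise_le[OF that(1)] raise_less[OF that(1)] that(2) by (auto simp: less le_tamari_B)
  have step: "\<exists>X a b c d. X \<in> triangulations_B n \<and> X \<sqsubseteq>\<^bsub>tamari_B n\<^esub> Y \<and> X = flip n S (seg n (b, d)) \<and>
      up_quad (n + 1) (edges n S) a b c d" if Y: "Y \<in> triangulations_B n" "S \<sqsubset>\<^bsub>tamari_B n\<^esub> Y" for Y
  proof -
    have "edges n Y \<noteq> edges n S" using Y edges_inject[OF Y(1) S] less by blast
    then obtain a b c d where Q: "up_quad (n + 1) (edges n S) a b c d"
      and le: "\<And>v. n + 1 < v \<Longrightarrow> v < 2 * (n + 1) \<Longrightarrow> left_end (edges n Y) v \<le> left_end (?R a b c d) v"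
      using raise_towards[OF edges_triangulation[OF n Y(1)]] Y(2) unfolding less le_tamari_B by metis
    let ?X = "seg n ` (?R a b c d - boundary (n + 1))"
    interpret R: symmetric_triangulation "n + 1" "?R a b c d" by (rule raise_triangulation[OF Q])
    have eX: "edges n ?X = ?R a b c d" by (rule edges_of_chords[OF R.boundary_E R.E_pairs])
    have X: "?X \<in> triangulations_B n" by (rule triangulation_of_edges) unfold_locales
    have "flip n S (seg n (b, d)) \<subseteq> chords n" using flip_subset_chords[OF n S Q] .
    then have "?X = flip n S (seg n (b, d))"
      using chords_of_edges[of "flip n S (seg n (b, d))" n] edges_flip[OF n S Q] by simp
    moreover have "?X \<sqsubseteq>\<^bsub>tamari_B n\<^esub> Y" unfolding le_tamari_B eX using le by blast
    ultimately show ?thesis using X Q by blast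
  qed
  show ?thesis
  proof
    assume cov: "covered_by (tamari_B n) S T"
    then have "S \<sqsubset>\<^bsub>tamari_B n\<^esub> T" by (simp add: covered_by_def)
    then obtain X a b c d where X: "X \<in> triangulations_B n" "X \<sqsubseteq>\<^bsub>tamari_B n\<^esub> T" "X = flip n S (seg n (b, d))"
      and Q: "up_quad (n + 1) (edges n S) a b c d"
      using step[OF T] by blast
    have "S \<sqsubset>\<^bsub>tamari_B n\<^esub> X" using up[OF Q] edges_flip[OF n S Q] X(3) by simp
    then have "X = T" using cov X(1,2) less unfolding covered_by_def carrier_tamari_B by blast
    then show "\<exists>C\<in>S. green n S C \<and> T = flip n S C" using X(3) green_of_up_quad[OF n S Q] by blast
  next
    assume "\<exists>C\<in>S. green n S C \<and> T = flip n S C"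
    then obtain C where C: "C \<in> S" "green n S C" "T = flip n S C" by blast
    then obtain a b c d where Q: "up_quad (n + 1) (edges n S) a b c d"
      and C': "C = seg n (b, d) \<or> bar ` C = seg n (b, d)"
      using up_quad_of_green[OF n S] by blast
    have F: "T = flip n S (seg n (b, d))" using C' C(3) flip_bar[of n S C] by auto
    have eT: "edges n T = ?R a b c d" unfolding F by (rule edges_flip[OF n S Q])
    have "\<not> (S \<sqsubset>\<^bsub>tamari_B n\<^esub> Z \<and> Z \<sqsubset>\<^bsub>tamari_B n\<^esub> T)" if Z: "Z \<in> triangulations_B n" for Z
    proof
      assume SZT: "S \<sqsubset>\<^bsub>tamari_B n\<^esub> Z \<and> Z \<sqsubset>\<^bsub>tamari_B n\<^esub> T"
      then obtain X a' b' c' d' where X: "X \<in> triangulations_B n" "X \<sqsubseteq>\<^bsub>tamari_B n\<^esub> Z"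
        "X = flip n S (seg n (b', d'))" and Q': "up_quad (n + 1) (edges n S) a' b' c' d'"
        using step[OF Z] by blast
      have eX: "edges n X = ?R a' b' c' d'" unfolding X(3) by (rule edges_flip[OF n S Q'])
      have "X \<sqsubseteq>\<^bsub>tamari_B n\<^esub> T"
        using L.le_trans[of X Z T] X(1,2) Z T SZT less unfolding carrier_tamari_B by blast
      then have "(b', d') = (b, d) \<or> (b', d') = opp (n + 1) (b, d)"
        using eT eX by (intro comparable_raises[OF Q Q']) (simp add: le_tamari_B)
      moreover have "(b, d) \<in> pairs (n + 1)" using Q E_pairs by (auto simp: up_quad_def)
      ultimately have "seg n (b', d') = seg n (b, d) \<or> seg n (b', d') = bar ` seg n (b, d)"
        using bar_seg[of "(b, d)" n] by metis
      then have "X = T" using X(3) F flip_bar[of n S "seg n (b, d)"] by auto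
      then have "Z = T" using L.le_antisym[of Z T] X(1,2) Z T SZT less unfolding carrier_tamari_B by blast
      then show False using SZT less by blast
    qed
    then show "covered_by (tamari_B n) S T"
      using S T up[OF Q eT] by (simp add: covered_by_def carrier_tamari_B)
  qed
qed

theorem theorem1:
  fixes n :: nat
  assumes "1 \<le> n"
  shows "(\<exists>L :: vertex set set gorder.
            carrier L = triangulations_B n \<and> lattice L \<and>
            (\<forall>S\<in>triangulations_B n. \<forall>T\<in>triangulations_B n.
               covered_by L S T \<longleftrightarrow> (\<exists>C\<in>S. green n S C \<and> T = flip n S C))) \<and>
         (\<forall>S\<in>triangulations_B n. \<forall>T\<in>triangulations_B n. \<forall>C\<in>S.
            green n S C \<and> T = flip n S C \<longrightarrow>
            green n S (bar ` C) \<and>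
            red n T (other_diagonal n S C) \<and> red n T (other_diagonal n S (bar ` C)))"
proof (intro conjI exI[of _ "tamari_B n"] ballI impI; (elim conjE)?)
  show "carrier (tamari_B n) = triangulations_B n" by (rule carrier_tamari_B)
  show "lattice (tamari_B n)" by (rule lattice_tamari_B[OF assms])
  fix S T assume S: "S \<in> triangulations_B n" and T: "T \<in> triangulations_B n"
  show "covered_by (tamari_B n) S T \<longleftrightarrow> (\<exists>C\<in>S. green n S C \<and> T = flip n S C)"
    by (rule covered_by_tamari_B[OF assms S T])
  fix C assume C: "C \<in> S" "green n S C" "T = flip n S C"
  have F: "flip n S C \<in> triangulations_B n" using T C(3) by simp
  show "green n S (bar ` C)" using C(2) red_bar[OF S] by simp
  show red: "red n T (other_diagonal n S C)"
    unfolding C(3) by (rule red_after_flip[OF assms S C(1,2) F])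
  then show "red n T (other_diagonal n S (bar ` C))"
    unfolding other_diagonal_bar[OF S] using red_bar[OF T] by simp
qed

end
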